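(* There exists no unitary $V\in M_2(\mathbb{C})\otimes\mathcal{Q}_2\cong M_2(\mathcal{Q}_2)$ such that $VT_2=T_1$, $VT_1=T_2V$, and $ZVZ^*=V^*$, where $$T_1=\frac{1}{\sqrt2}\begin{pmatrix}S_1&S_2\\ S_1&S_2\end{pmatrix},\qquad T_2=\frac{1}{\sqrt2}\begin{pmatrix}S_1&-S_2\\-S_1&S_2\end{pmatrix},\qquad Z=\begin{pmatrix}1&0\\0&-1\end{pmatrix}.$$
   Context: $\mathcal{Q}_2$ is the $2$-adic ring $C^*$-algebra: the universal $C^*$-algebra generated by a unitary $U$ and a (proper) isometry $S_2$ such that $S_2U=U^2S_2$ and $S_2S_2^*+US_2S_2^*U^*=1$. One sets $S_1:=US_2\in\mathcal{Q}_2$; then $S_1,S_2$ are isometries with $S_1S_1^*+S_2S_2^*=1$, so they generate a copy of the Cuntz algebra $\mathcal{O}_2$ inside $\mathcal{Q}_2$. *)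

theory Defs
  imports Complex_Main "HOL-Algebra.Module" "HOL-Algebra.Subrings"
begin

record 'a star_alg = "(complex, 'a) module" +
  star :: "'a \<Rightarrow> 'a"

record 'a normed_star_alg = "'a star_alg" +
  nrm :: "'a \<Rightarrow> real"

text \<open>Unital complex C*-algebras on a carrier set; the zero algebra is allowed.\<close>

locale unital_cstar_algebra = ring A for A :: "('a, 'm) normed_star_alg_scheme" (structure) +
  assumes smult_closed: "x \<in> carrier A \<Longrightarrow> c \<odot> x \<in> carrier A"
    and smult_add_left: "x \<in> carrier A \<Longrightarrow> (c + d) \<odot> x = (c \<odot> x) \<oplus> (d \<odot> x)"
    and smult_add_right:
      "\<lbrakk>x \<in> carrier A; y \<in> carrier A\<rbrakk> \<Longrightarrow> c \<odot> (x \<oplus> y) = (c \<odot> x) \<oplus> (c \<odot> y)"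
    and smult_smult: "x \<in> carrier A \<Longrightarrow> (c * d) \<odot> x = c \<odot> (d \<odot> x)"
    and smult_one: "x \<in> carrier A \<Longrightarrow> 1 \<odot> x = x"
    and smult_mult_left:
      "\<lbrakk>x \<in> carrier A; y \<in> carrier A\<rbrakk> \<Longrightarrow> (c \<odot> x) \<otimes> y = c \<odot> (x \<otimes> y)"
    and smult_mult_right:
      "\<lbrakk>x \<in> carrier A; y \<in> carrier A\<rbrakk> \<Longrightarrow> x \<otimes> (c \<odot> y) = c \<odot> (x \<otimes> y)"
    and star_closed: "x \<in> carrier A \<Longrightarrow> star A x \<in> carrier A"
    and star_star: "x \<in> carrier A \<Longrightarrow> star A (star A x) = x"
    and star_add:
      "\<lbrakk>x \<in> carrier A; y \<in> carrier A\<rbrakk> \<Longrightarrow> star A (x \<oplus> y) = star A x \<oplus> star A y"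
    and star_smult: "x \<in> carrier A \<Longrightarrow> star A (c \<odot> x) = cnj c \<odot> star A x"
    and star_mult:
      "\<lbrakk>x \<in> carrier A; y \<in> carrier A\<rbrakk> \<Longrightarrow> star A (x \<otimes> y) = star A y \<otimes> star A x"
    and nrm_nonneg: "x \<in> carrier A \<Longrightarrow> 0 \<le> nrm A x"
    and nrm_eq_zero: "x \<in> carrier A \<Longrightarrow> nrm A x = 0 \<longleftrightarrow> x = \<zero>"
    and nrm_triangle:
      "\<lbrakk>x \<in> carrier A; y \<in> carrier A\<rbrakk> \<Longrightarrow> nrm A (x \<oplus> y) \<le> nrm A x + nrm A y"
    and nrm_smult: "x \<in> carrier A \<Longrightarrow> nrm A (c \<odot> x) = cmod c * nrm A x"
    and nrm_mult:
      "\<lbrakk>x \<in> carrier A; y \<in> carrier A\<rbrakk> \<Longrightarrow> nrm A (x \<otimes> y) \<le> nrm A x * nrm A y"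
    and nrm_cstar: "x \<in> carrier A \<Longrightarrow> nrm A (star A x \<otimes> x) = (nrm A x)\<^sup>2"
    and complete:
      "\<lbrakk>\<And>n. X n \<in> carrier A;
        \<forall>\<epsilon>>0. \<exists>N. \<forall>m\<ge>N. \<forall>n\<ge>N. nrm A (X m \<ominus> X n) < \<epsilon>\<rbrakk>
       \<Longrightarrow> \<exists>x\<in>carrier A. (\<lambda>n. nrm A (X n \<ominus> x)) \<longlonglongrightarrow> 0"

definition cstar_subalgebra :: "'a set \<Rightarrow> ('a, 'm) normed_star_alg_scheme \<Rightarrow> bool" where
  "cstar_subalgebra B A \<longleftrightarrow>
     subring B A \<and>
     (\<forall>c. \<forall>x\<in>B. c \<odot>\<^bsub>A\<^esub> x \<in> B) \<and>
     (\<forall>x\<in>B. star A x \<in> B) \<and>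
     (\<forall>X. \<forall>x\<in>carrier A. (\<forall>n. X n \<in> B) \<longrightarrow>
        (\<lambda>n. nrm A (X n \<ominus>\<^bsub>A\<^esub> x)) \<longlonglongrightarrow> 0 \<longrightarrow> x \<in> B)"

definition cstar_generated_by :: "('a, 'm) normed_star_alg_scheme \<Rightarrow> 'a set \<Rightarrow> bool" where
  "cstar_generated_by A G \<longleftrightarrow>
     G \<subseteq> carrier A \<and> (\<forall>B. cstar_subalgebra B A \<longrightarrow> G \<subseteq> B \<longrightarrow> B = carrier A)"

definition star_hom ::
  "('a, 'm) star_alg_scheme \<Rightarrow> ('b, 'n) star_alg_scheme \<Rightarrow> ('a \<Rightarrow> 'b) set" where
  "star_hom A B = {\<phi> \<in> ring_hom A B.
     (\<forall>c. \<forall>x\<in>carrier A. \<phi> (c \<odot>\<^bsub>A\<^esub> x) = c \<odot>\<^bsub>B\<^esub> \<phi> x) \<and>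
     (\<forall>x\<in>carrier A. \<phi> (star A x) = star B (\<phi> x))}"

definition is_unitary :: "('a, 'm) star_alg_scheme \<Rightarrow> 'a \<Rightarrow> bool" where
  "is_unitary A u \<longleftrightarrow>
     u \<in> carrier A \<and> star A u \<otimes>\<^bsub>A\<^esub> u = \<one>\<^bsub>A\<^esub> \<and> u \<otimes>\<^bsub>A\<^esub> star A u = \<one>\<^bsub>A\<^esub>"

definition is_isometry :: "('a, 'm) star_alg_scheme \<Rightarrow> 'a \<Rightarrow> bool" where
  "is_isometry A s \<longleftrightarrow> s \<in> carrier A \<and> star A s \<otimes>\<^bsub>A\<^esub> s = \<one>\<^bsub>A\<^esub>"

definition two_adic_relations :: "('a, 'm) star_alg_scheme \<Rightarrow> 'a \<Rightarrow> 'a \<Rightarrow> bool" where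
  "two_adic_relations A u s \<longleftrightarrow>
     is_unitary A u \<and> is_isometry A s \<and>
     s \<otimes>\<^bsub>A\<^esub> u = u [^]\<^bsub>A\<^esub> (2::nat) \<otimes>\<^bsub>A\<^esub> s \<and>
     s \<otimes>\<^bsub>A\<^esub> star A s \<oplus>\<^bsub>A\<^esub> u \<otimes>\<^bsub>A\<^esub> s \<otimes>\<^bsub>A\<^esub> star A s \<otimes>\<^bsub>A\<^esub> star A u = \<one>\<^bsub>A\<^esub>"

text \<open>
  A formula cannot quantify over all types, so the universal property is tested on the C*-algebras
  carried by sets of functions on complex sequences. This loses nothing: in any unital
  C*-algebra, of any type, a pair satisfying the relations generates a separable C*-subalgebra,
  which is isomorphic to an algebra of bounded operators on the Hilbert space of square-summable
  sequences (extended by zero to all sequences) and thus has a copy of the type below.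
  The homomorphism is unique because \<open>U\<close> and \<open>S2\<close> generate.
\<close>

type_synonym sequence_operator = "(nat \<Rightarrow> complex) \<Rightarrow> (nat \<Rightarrow> complex)"

definition is_two_adic_ring_algebra :: "'a normed_star_alg \<Rightarrow> 'a \<Rightarrow> 'a \<Rightarrow> bool" where
  "is_two_adic_ring_algebra A U S2 \<longleftrightarrow>
     unital_cstar_algebra A \<and> two_adic_relations A U S2 \<and> cstar_generated_by A {U, S2} \<and>
     (\<forall>(B :: sequence_operator normed_star_alg) u s.
        unital_cstar_algebra B \<and> two_adic_relations B u s \<longrightarrow>
        (\<exists>\<phi>\<in>star_hom A B. \<phi> U = u \<and> \<phi> S2 = s))"

datatype 'a mat2 = Mat2 (e11: 'a) (e12: 'a) (e21: 'a) (e22: 'a)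

definition mat2_alg :: "('a, 'm) star_alg_scheme \<Rightarrow> 'a mat2 star_alg" where
  "mat2_alg A = \<lparr>
     carrier = {X. set_mat2 X \<subseteq> carrier A},
     monoid.mult = (\<lambda>X Y. Mat2
       (e11 X \<otimes>\<^bsub>A\<^esub> e11 Y \<oplus>\<^bsub>A\<^esub> e12 X \<otimes>\<^bsub>A\<^esub> e21 Y) (e11 X \<otimes>\<^bsub>A\<^esub> e12 Y \<oplus>\<^bsub>A\<^esub> e12 X \<otimes>\<^bsub>A\<^esub> e22 Y)
       (e21 X \<otimes>\<^bsub>A\<^esub> e11 Y \<oplus>\<^bsub>A\<^esub> e22 X \<otimes>\<^bsub>A\<^esub> e21 Y) (e21 X \<otimes>\<^bsub>A\<^esub> e12 Y \<oplus>\<^bsub>A\<^esub> e22 X \<otimes>\<^bsub>A\<^esub> e22 Y)),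
     one = Mat2 \<one>\<^bsub>A\<^esub> \<zero>\<^bsub>A\<^esub> \<zero>\<^bsub>A\<^esub> \<one>\<^bsub>A\<^esub>,
     ring.zero = Mat2 \<zero>\<^bsub>A\<^esub> \<zero>\<^bsub>A\<^esub> \<zero>\<^bsub>A\<^esub> \<zero>\<^bsub>A\<^esub>,
     ring.add = (\<lambda>X Y. Mat2
       (e11 X \<oplus>\<^bsub>A\<^esub> e11 Y) (e12 X \<oplus>\<^bsub>A\<^esub> e12 Y)
       (e21 X \<oplus>\<^bsub>A\<^esub> e21 Y) (e22 X \<oplus>\<^bsub>A\<^esub> e22 Y)),
     smult = (\<lambda>c. map_mat2 (smult A c)),
     star = (\<lambda>X. Mat2 (star A (e11 X)) (star A (e21 X)) (star A (e12 X)) (star A (e22 X)))\<rparr>"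

end

theory Submission
  imports Defs "HOL-Analysis.Infinite_Sum" "HOL-Analysis.L2_Norm" "HOL-Library.Function_Algebras"
    "HOL-Library.Nat_Bijection"
begin

text \<open>
  Write \<open>S = S2\<close>, \<open>S1 = U S\<close>, and let \<open>V\<close> have the rows \<open>(a, b)\<close> and \<open>(c, d)\<close>. The relation
  \<open>V T2 = T1\<close> forces \<open>a - b = c - d = P\<close> with \<open>P = S1 S1* - S S*\<close>, and \<open>Z V Z* = V*\<close> then leaves
  \<open>c = -b\<close> and \<open>d = -a\<close>. In terms of the isometries \<open>R = (S1 + S) / sqrt 2\<close> and
  \<open>Q = (S1 - S) / sqrt 2\<close>, which have orthogonal ranges, the remaining relation \<open>V T1 = T2 V\<close> says
  that \<open>W = a + b\<close> satisfies \<open>W R = R W\<close> and \<open>W Q = Q P\<close>. Consequently the compressions of \<open>W\<close> to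
  the isometries \<open>K N = R^N Q\<close> never change: \<open>(K N)* W (K N) = P\<close> for every \<open>N\<close>
  (\<open>K_star_intertwiner_K\<close>).

  Every element of the algebra, however, has compressions that become arbitrarily close to scalars
  (\<open>eventually_scalar\<close>). The identity \<open>(U - 1) R = S (U - 1) / sqrt 2\<close> gives
  \<open>(U - 1) R^N = 2^(-N/2) S^N (U - 1)\<close>, so powers of \<open>U\<close> act on \<open>K N\<close> like the identity in the
  limit; and \<open>S* R = 1 / sqrt 2\<close> together with the orthogonality of the \<open>K N\<close> makes the
  compression of \<open>S^n S*^m\<close> exactly scalar for large \<open>N\<close>. The products of such elements span a dense
  subspace (\<open>closed_span_monomials\<close>). In the canonical representation on the sequences indexed by
  the integers, \<open>K N\<close> maps the unit vectors to the Haar wavelets of scale \<open>N\<close>, and \<open>W\<close> multiplies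
  wavelets by alternating signs on every scale; such an operator is a strong limit of elements of the
  algebra, but not a norm limit.

  Finally \<open>P\<close> is not close to a scalar: it fixes \<open>S1\<close> and negates \<open>S\<close>, so a scalar \<open>l\<close> with
  \<open>norm (P - l) < 1\<close> would satisfy \<open>|1 - l| < 1\<close> and \<open>|1 + l| < 1\<close>. This contradiction presupposes
  \<open>1 \<noteq> 0\<close>. As the zero algebra does satisfy the generators' relations, the universal property has
  to enter here: it yields a unital homomorphism into the bounded operators on the square-summable
  sequences, where a shift and a doubling operator satisfy the relations. That C*-algebra is
  constructed below (\<open>unital_cstar_algebra_l2_operators\<close>, \<open>two_adic_relations_l2_operators\<close>).
\<close>

section \<open>Elementary facts about unital C*-algebras\<close>

context unital_cstar_algebra
begin

abbreviation adjoint :: "'a \<Rightarrow> 'a" ("_\<^sup>\<star>" [1000] 999)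
  where "x\<^sup>\<star> \<equiv> star A x"

lemmas smult_simps = smult_closed smult_add_right smult_mult_left smult_mult_right
  smult_smult [symmetric] star_smult

lemma smult_zero_left: "x \<in> carrier A \<Longrightarrow> 0 \<odot> x = \<zero>"
  using smult_add_left [of x 0 0] by (simp add: smult_closed)

lemma smult_zero_right: "c \<odot> \<zero> = \<zero>"
  using smult_add_right [of \<zero> \<zero> c] by (simp add: smult_closed)

lemma smult_minus_one: "x \<in> carrier A \<Longrightarrow> (-1) \<odot> x = \<ominus> x"
  using smult_add_left [of x 1 "-1"]
  by (metis add.inv_equality add.inv_inv smult_closed smult_one smult_zero_left
      add.right_inverse)

lemma smult_uminus: "x \<in> carrier A \<Longrightarrow> c \<odot> (\<ominus> x) = \<ominus> (c \<odot> x)"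
  by (metis mult.commute smult_closed smult_minus_one smult_smult)

lemma smult_diff: "x \<in> carrier A \<Longrightarrow> y \<in> carrier A \<Longrightarrow> c \<odot> (x \<ominus> y) = c \<odot> x \<ominus> c \<odot> y"
  by (simp add: minus_eq smult_add_right smult_uminus)

lemma star_uminus: "x \<in> carrier A \<Longrightarrow> (\<ominus> x)\<^sup>\<star> = \<ominus> x\<^sup>\<star>"
  by (metis complex_cnj_minus complex_cnj_one smult_minus_one star_closed star_smult)

lemma star_diff: "x \<in> carrier A \<Longrightarrow> y \<in> carrier A \<Longrightarrow> (x \<ominus> y)\<^sup>\<star> = x\<^sup>\<star> \<ominus> y\<^sup>\<star>"
  by (simp add: minus_eq star_add star_uminus)

lemma star_zero: "\<zero>\<^sup>\<star> = \<zero>"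
  by (metis complex_cnj_zero smult_zero_left star_closed star_smult zero_closed)

lemma star_one: "\<one>\<^sup>\<star> = \<one>"
  by (metis l_one one_closed r_one star_closed star_mult star_star)

lemmas star_simps = star_closed star_star star_add star_mult star_uminus star_diff
  star_zero star_one

lemma nrm_zero: "nrm A \<zero> = 0"
  by (simp add: nrm_eq_zero)

lemma nrm_uminus: "x \<in> carrier A \<Longrightarrow> nrm A (\<ominus> x) = nrm A x"
  by (metis mult.left_neutral norm_minus_cancel norm_one nrm_smult smult_minus_one)

lemma nrm_diff_commute:
  assumes "x \<in> carrier A" "y \<in> carrier A"
  shows "nrm A (x \<ominus> y) = nrm A (y \<ominus> x)"
proof -
  have "\<ominus> (x \<ominus> y) = y \<ominus> x" using assms by algebra
  then show ?thesis using nrm_uminus [of "x \<ominus> y"] assms by simp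
qed

lemma nrm_diff_trans:
  assumes "x \<in> carrier A" "y \<in> carrier A" "z \<in> carrier A"
  shows "nrm A (x \<ominus> z) \<le> nrm A (x \<ominus> y) + nrm A (y \<ominus> z)"
proof -
  have "x \<ominus> z = (x \<ominus> y) \<oplus> (y \<ominus> z)" using assms by algebra
  then show ?thesis using nrm_triangle [of "x \<ominus> y" "y \<ominus> z"] assms by simp
qed

text \<open>
  The C*-identity and submultiplicativity give \<open>norm x \<le> norm x*\<close> after cancelling one factor
  \<open>norm x\<close>; the reverse inequality is the same statement for \<open>x*\<close>.
\<close>

lemma nrm_star:
  assumes "x \<in> carrier A"
  shows "nrm A (x\<^sup>\<star>) = nrm A x"
proof -
  have le: "nrm A y \<le> nrm A (y\<^sup>\<star>)" if y: "y \<in> carrier A" for y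
  proof (cases "nrm A y = 0")
    case False
    have "nrm A y * nrm A y \<le> nrm A (y\<^sup>\<star>) * nrm A y"
      using nrm_cstar [OF y] nrm_mult [of "y\<^sup>\<star>" y] y by (simp add: star_closed power2_eq_square)
    then show ?thesis using False nrm_nonneg [OF y] by simp
  qed (use y in \<open>simp add: nrm_nonneg star_closed\<close>)
  show ?thesis using le [OF assms] le [of "x\<^sup>\<star>"] assms by (simp add: star_closed star_star)
qed

lemma nrm_one: "\<one> \<noteq> \<zero> \<Longrightarrow> nrm A \<one> = 1"
  using nrm_cstar [OF one_closed] nrm_eq_zero [OF one_closed]
  by (simp add: star_one power2_eq_square)

lemma nrm_isometry_le:
  assumes "x \<in> carrier A" "x\<^sup>\<star> \<otimes> x = \<one>"
  shows "nrm A x \<le> 1"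
proof (cases "\<one> = \<zero>")
  case True
  then have "x = \<zero>" using assms(1) by (metis l_null l_one)
  then show ?thesis by (simp add: nrm_zero)
next
  case False
  then show ?thesis using nrm_cstar [OF assms(1)] nrm_one assms
    by (auto simp: power2_eq_1_iff)
qed

lemma nrm_isometry:
  assumes "x \<in> carrier A" "x\<^sup>\<star> \<otimes> x = \<one>" "\<one> \<noteq> \<zero>"
  shows "nrm A x = 1"
  using nrm_cstar [OF assms(1)] nrm_one assms nrm_nonneg [OF assms(1)]
  by (simp add: power2_eq_1_iff)

lemma nrm_mult_le:
  assumes "x \<in> carrier A" "y \<in> carrier A" "nrm A x \<le> a" "nrm A y \<le> b"
  shows "nrm A (x \<otimes> y) \<le> a * b"
  by (meson assms mult_mono nrm_mult nrm_nonneg order_trans)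

section \<open>Closed subspaces and generation\<close>

definition closed_subspace :: "'a set \<Rightarrow> bool" where
  "closed_subspace E \<longleftrightarrow> E \<subseteq> carrier A \<and> \<zero> \<in> E \<and>
     (\<forall>x\<in>E. \<forall>y\<in>E. x \<oplus> y \<in> E) \<and> (\<forall>c. \<forall>x\<in>E. c \<odot> x \<in> E) \<and>
     (\<forall>X. \<forall>x\<in>carrier A. (\<forall>n. X n \<in> E) \<longrightarrow> (\<lambda>n. nrm A (X n \<ominus> x)) \<longlonglongrightarrow> 0 \<longrightarrow> x \<in> E)"

lemma closed_subspaceI:
  assumes "E \<subseteq> carrier A" "\<zero> \<in> E" "\<And>x y. x \<in> E \<Longrightarrow> y \<in> E \<Longrightarrow> x \<oplus> y \<in> E"
    and "\<And>c x. x \<in> E \<Longrightarrow> c \<odot> x \<in> E"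
    and "\<And>X x. x \<in> carrier A \<Longrightarrow> (\<And>n. X n \<in> E) \<Longrightarrow> (\<lambda>n. nrm A (X n \<ominus> x)) \<longlonglongrightarrow> 0 \<Longrightarrow> x \<in> E"
  shows "closed_subspace E"
  unfolding closed_subspace_def using assms by blast

lemma closed_subspaceD:
  assumes "closed_subspace E"
  shows "E \<subseteq> carrier A" "\<zero> \<in> E" "\<And>x y. x \<in> E \<Longrightarrow> y \<in> E \<Longrightarrow> x \<oplus> y \<in> E"
    and "\<And>c x. x \<in> E \<Longrightarrow> c \<odot> x \<in> E"
    and "\<And>X x. x \<in> carrier A \<Longrightarrow> (\<And>n. X n \<in> E) \<Longrightarrow> (\<lambda>n. nrm A (X n \<ominus> x)) \<longlonglongrightarrow> 0 \<Longrightarrow> x \<in> E"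
  using assms unfolding closed_subspace_def by blast+

lemma closed_subspace_carrier: "closed_subspace (carrier A)"
  by (rule closed_subspaceI) (auto simp: smult_closed)

definition closed_span :: "'a set \<Rightarrow> 'a set" where
  "closed_span G = \<Inter> {E. closed_subspace E \<and> G \<subseteq> E}"

lemma closed_span_superset: "G \<subseteq> closed_span G"
  unfolding closed_span_def by blast

lemma closed_span_minimal: "closed_subspace E \<Longrightarrow> G \<subseteq> E \<Longrightarrow> closed_span G \<subseteq> E"
  unfolding closed_span_def by blast

lemma closed_subspace_closed_span:
  assumes "G \<subseteq> carrier A"
  shows "closed_subspace (closed_span G)"
proof (rule closed_subspaceI)
  show "closed_span G \<subseteq> carrier A"
    using closed_span_minimal [OF closed_subspace_carrier assms] .
next
  fix X x
  assume "x \<in> carrier A" "\<And>n. X n \<in> closed_span G" "(\<lambda>n. nrm A (X n \<ominus> x)) \<longlonglongrightarrow> 0"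
  then show "x \<in> closed_span G"
    unfolding closed_span_def by (blast intro: closed_subspaceD(5))
qed (auto simp: closed_span_def intro: closed_subspaceD(2-4))

lemma tendsto_zero_bound:
  fixes f g :: "nat \<Rightarrow> real"
  assumes "g \<longlonglongrightarrow> 0" "\<And>n. 0 \<le> f n" "\<And>n. f n \<le> C * g n"
  shows "f \<longlonglongrightarrow> 0"
proof (rule tendsto_sandwich [of "\<lambda>_. 0"])
  show "(\<lambda>n. C * g n) \<longlonglongrightarrow> 0" using tendsto_mult_left [OF assms(1), of C] by simp
qed (use assms in auto)

lemma limit_mult_left:
  assumes "\<And>n. X n \<in> carrier A" "x \<in> carrier A" "y \<in> carrier A"
    and "(\<lambda>n. nrm A (X n \<ominus> x)) \<longlonglongrightarrow> 0"
  shows "(\<lambda>n. nrm A (y \<otimes> X n \<ominus> y \<otimes> x)) \<longlonglongrightarrow> 0"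
proof (rule tendsto_zero_bound [OF assms(4), of _ "nrm A y"])
  fix n
  have "y \<otimes> X n \<ominus> y \<otimes> x = y \<otimes> (X n \<ominus> x)" using assms(1) [of n] assms(2,3) by algebra
  then show "nrm A (y \<otimes> X n \<ominus> y \<otimes> x) \<le> nrm A y * nrm A (X n \<ominus> x)"
    using assms by (simp add: nrm_mult)
qed (use assms in \<open>simp add: nrm_nonneg\<close>)

lemma limit_mult_right:
  assumes "\<And>n. X n \<in> carrier A" "x \<in> carrier A" "y \<in> carrier A"
    and "(\<lambda>n. nrm A (X n \<ominus> x)) \<longlonglongrightarrow> 0"
  shows "(\<lambda>n. nrm A (X n \<otimes> y \<ominus> x \<otimes> y)) \<longlonglongrightarrow> 0"
proof (rule tendsto_zero_bound [OF assms(4), of _ "nrm A y"])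
  fix n
  have "X n \<otimes> y \<ominus> x \<otimes> y = (X n \<ominus> x) \<otimes> y" using assms(1) [of n] assms(2,3) by algebra
  then show "nrm A (X n \<otimes> y \<ominus> x \<otimes> y) \<le> nrm A y * nrm A (X n \<ominus> x)"
    using assms nrm_mult [of "X n \<ominus> x" y] by (simp add: mult.commute)
qed (use assms in \<open>simp add: nrm_nonneg\<close>)

lemma limit_star:
  assumes "\<And>n. X n \<in> carrier A" "x \<in> carrier A" "(\<lambda>n. nrm A (X n \<ominus> x)) \<longlonglongrightarrow> 0"
  shows "(\<lambda>n. nrm A ((X n)\<^sup>\<star> \<ominus> x\<^sup>\<star>)) \<longlonglongrightarrow> 0"
  using assms by (simp add: nrm_star star_diff [symmetric])

lemma closed_subspace_left_preimage:
  assumes "closed_subspace E" "y \<in> carrier A"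
  shows "closed_subspace {x \<in> carrier A. y \<otimes> x \<in> E}"
proof (rule closed_subspaceI)
  fix X x
  assume "x \<in> carrier A" "\<And>n. X n \<in> {x \<in> carrier A. y \<otimes> x \<in> E}" "(\<lambda>n. nrm A (X n \<ominus> x)) \<longlonglongrightarrow> 0"
  then show "x \<in> {x \<in> carrier A. y \<otimes> x \<in> E}"
    using closed_subspaceD(5) [OF assms(1), of "y \<otimes> x" "\<lambda>n. y \<otimes> X n"] limit_mult_left [of X x y] assms(2)
    by auto
qed (use assms(2) closed_subspaceD(2-4) [OF assms(1)] in
  \<open>auto simp: smult_closed r_distr smult_mult_right\<close>)

text \<open>
  The elements \<open>x\<close> for which both \<open>x\<close> and \<open>x*\<close> map \<open>E\<close> into itself form a C*-subalgebra. It
  contains the generators, hence it is the whole algebra, and \<open>x = x 1\<close> then lies in \<open>E\<close>. This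
  replaces the reduction of products of two arbitrary words by that of a generator times a word.
\<close>

theorem left_invariant_closed_subspace_eq_carrier:
  assumes gen: "cstar_generated_by A G"
    and E: "closed_subspace E" and one: "\<one> \<in> E"
    and inv: "\<And>g x. g \<in> G \<Longrightarrow> x \<in> E \<Longrightarrow> g \<otimes> x \<in> E \<and> g\<^sup>\<star> \<otimes> x \<in> E"
  shows "E = carrier A"
proof
  let ?B = "{x \<in> carrier A. \<forall>y\<in>E. x \<otimes> y \<in> E \<and> x\<^sup>\<star> \<otimes> y \<in> E}"
  note Ec = subsetD [OF closed_subspaceD(1) [OF E]]
  note Ei = closed_subspaceD(2-4) [OF E]
  have neg: "\<ominus> x \<in> E" if "x \<in> E" for x
    using Ei(3) [OF that, of "-1"] Ec [OF that] by (simp add: smult_minus_one)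
  have "subring ?B A"
  proof (rule subringI)
    fix x y assume "x \<in> ?B" "y \<in> ?B"
    then show "x \<otimes> y \<in> ?B" "x \<oplus> y \<in> ?B"
      by (simp_all add: star_simps m_assoc l_distr Ec Ei(2))
  qed (auto simp: one star_simps l_minus Ec neg)
  moreover have "\<forall>c. \<forall>x\<in>?B. c \<odot> x \<in> ?B"
    by (auto simp: smult_closed smult_mult_left star_smult Ec star_closed intro!: Ei(3))
  moreover have "\<forall>x\<in>?B. x\<^sup>\<star> \<in> ?B"
    by (auto simp: star_closed star_star)
  moreover have lim: "x \<in> ?B" if x: "x \<in> carrier A" and X: "\<And>n. X n \<in> ?B"
      and lim: "(\<lambda>n. nrm A (X n \<ominus> x)) \<longlonglongrightarrow> 0" for X x
  proof -
    have "x \<otimes> y \<in> E" "x\<^sup>\<star> \<otimes> y \<in> E" if y: "y \<in> E" for y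
    proof -
      show "x \<otimes> y \<in> E"
        by (rule closed_subspaceD(5) [OF E, of _ "\<lambda>n. X n \<otimes> y"])
          (use X x y Ec lim in \<open>auto intro: limit_mult_right\<close>)
      show "x\<^sup>\<star> \<otimes> y \<in> E"
        by (rule closed_subspaceD(5) [OF E, of _ "\<lambda>n. (X n)\<^sup>\<star> \<otimes> y"])
          (use X x y Ec lim in \<open>auto simp: star_closed intro!: limit_mult_right limit_star\<close>)
    qed
    then show ?thesis using x by simp
  qed
  ultimately have "cstar_subalgebra ?B A"
    unfolding cstar_subalgebra_def by blast
  moreover have "G \<subseteq> ?B"
    using gen inv unfolding cstar_generated_by_def by auto
  ultimately have "?B = carrier A"
    using gen unfolding cstar_generated_by_def by blast
  then show "carrier A \<subseteq> E" using one by (metis (no_types, lifting) mem_Collect_eq r_one subsetI)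
qed (rule closed_subspaceD(1) [OF E])

text \<open>
  Compression by a contraction does not increase norms, so one approximant within \<open>\<epsilon> / 2\<close> of \<open>x\<close>
  decides the matter for all \<open>n\<close> at once. The scalar may vary with \<open>\<epsilon>\<close>, so closure under limits does
  not involve the convergence of scalars.
\<close>

lemma closed_subspace_eventually_scalar:
  assumes K: "\<And>n. K n \<in> carrier A" "\<And>n. nrm A (K n) \<le> 1"
  shows "closed_subspace {x \<in> carrier A. \<forall>\<epsilon>>0. \<exists>c.
    \<forall>\<^sub>F n in sequentially. nrm A ((K n)\<^sup>\<star> \<otimes> x \<otimes> K n \<ominus> c \<odot> \<one>) < \<epsilon>}"
    (is "closed_subspace ?B")
proof -
  define \<Psi> where "\<Psi> n x = (K n)\<^sup>\<star> \<otimes> x \<otimes> K n" for n x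
  have cl: "\<Psi> n x \<in> carrier A" if "x \<in> carrier A" for n x
    using that K by (simp add: \<Psi>_def star_closed)
  have bound: "nrm A (\<Psi> n x \<ominus> \<Psi> n y) \<le> nrm A (x \<ominus> y)" if "x \<in> carrier A" "y \<in> carrier A" for n x y
  proof -
    have "\<Psi> n x \<ominus> \<Psi> n y = (K n)\<^sup>\<star> \<otimes> (x \<ominus> y) \<otimes> K n"
      using that K(1) [of n] star_closed [OF K(1), of n] unfolding \<Psi>_def by algebra
    moreover have "nrm A ((K n)\<^sup>\<star> \<otimes> (x \<ominus> y) \<otimes> K n) \<le> (1 * nrm A (x \<ominus> y)) * 1"
      by (intro nrm_mult_le) (use that K in \<open>auto simp: nrm_star star_closed\<close>)
    ultimately show ?thesis by simp
  qed
  have B: "?B = {x \<in> carrier A. \<forall>\<epsilon>>0. \<exists>c. \<forall>\<^sub>F n in sequentially. nrm A (\<Psi> n x \<ominus> c \<odot> \<one>) < \<epsilon>}"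
    by (simp add: \<Psi>_def)
  show ?thesis
    unfolding B
  proof (rule closed_subspaceI, safe)
    show "\<exists>c. \<forall>\<^sub>F n in sequentially. nrm A (\<Psi> n \<zero> \<ominus> c \<odot> \<one>) < \<epsilon>" if "0 < \<epsilon>" for \<epsilon> :: real
      using that K by (intro exI [of _ 0]) (simp add: \<Psi>_def smult_zero_left nrm_zero star_closed minus_eq)
  next
    fix x y and \<epsilon> :: real
    assume xy: "x \<in> carrier A" "y \<in> carrier A" and \<epsilon>: "0 < \<epsilon>"
      and "\<forall>\<epsilon>>0. \<exists>c. \<forall>\<^sub>F n in sequentially. nrm A (\<Psi> n x \<ominus> c \<odot> \<one>) < \<epsilon>"
      and "\<forall>\<epsilon>>0. \<exists>c. \<forall>\<^sub>F n in sequentially. nrm A (\<Psi> n y \<ominus> c \<odot> \<one>) < \<epsilon>"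
    then obtain c d where
      c: "\<forall>\<^sub>F n in sequentially. nrm A (\<Psi> n x \<ominus> c \<odot> \<one>) < \<epsilon> / 2" and
      d: "\<forall>\<^sub>F n in sequentially. nrm A (\<Psi> n y \<ominus> d \<odot> \<one>) < \<epsilon> / 2"
      by (metis half_gt_zero)
    have "\<forall>\<^sub>F n in sequentially. nrm A (\<Psi> n (x \<oplus> y) \<ominus> (c + d) \<odot> \<one>) < \<epsilon>"
      using c d
    proof eventually_elim
      case (elim n)
      have "\<Psi> n (x \<oplus> y) = \<Psi> n x \<oplus> \<Psi> n y"
        using xy K(1) [of n] star_closed [OF K(1), of n] unfolding \<Psi>_def by algebra
      then have "\<Psi> n (x \<oplus> y) \<ominus> (c + d) \<odot> \<one> = (\<Psi> n x \<ominus> c \<odot> \<one>) \<oplus> (\<Psi> n y \<ominus> d \<odot> \<one>)"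
        using cl [OF xy(1), of n] cl [OF xy(2), of n]
          smult_closed [OF one_closed, of c] smult_closed [OF one_closed, of d]
        unfolding smult_add_left [OF one_closed] by algebra
      then show ?case
        using nrm_triangle [of "\<Psi> n x \<ominus> c \<odot> \<one>" "\<Psi> n y \<ominus> d \<odot> \<one>"] elim xy
        by (simp add: cl smult_closed)
    qed
    then show "\<exists>c. \<forall>\<^sub>F n in sequentially. nrm A (\<Psi> n (x \<oplus> y) \<ominus> c \<odot> \<one>) < \<epsilon>" ..
  next
    fix b x and \<epsilon> :: real
    assume x: "x \<in> carrier A" and \<epsilon>: "0 < \<epsilon>"
      and *: "\<forall>\<epsilon>>0. \<exists>c. \<forall>\<^sub>F n in sequentially. nrm A (\<Psi> n x \<ominus> c \<odot> \<one>) < \<epsilon>"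
    have pos: "0 < \<epsilon> / (cmod b + 1)" using \<epsilon> by (simp add: add_nonneg_pos)
    from * pos obtain c where
      c: "\<forall>\<^sub>F n in sequentially. nrm A (\<Psi> n x \<ominus> c \<odot> \<one>) < \<epsilon> / (cmod b + 1)" by blast
    have "\<forall>\<^sub>F n in sequentially. nrm A (\<Psi> n (b \<odot> x) \<ominus> (b * c) \<odot> \<one>) < \<epsilon>"
      using c
    proof eventually_elim
      case (elim n)
      have "\<Psi> n (b \<odot> x) \<ominus> (b * c) \<odot> \<one> = b \<odot> (\<Psi> n x \<ominus> c \<odot> \<one>)"
        using x K(1) [of n] star_closed [OF K(1), of n] cl [OF x, of n]
        by (simp add: smult_diff smult_closed smult_smult)
          (simp add: \<Psi>_def smult_closed smult_mult_left smult_mult_right)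
      then have "nrm A (\<Psi> n (b \<odot> x) \<ominus> (b * c) \<odot> \<one>) = cmod b * nrm A (\<Psi> n x \<ominus> c \<odot> \<one>)"
        using x by (simp add: nrm_smult cl smult_closed)
      also have "\<dots> \<le> (cmod b + 1) * nrm A (\<Psi> n x \<ominus> c \<odot> \<one>)"
        using x by (intro mult_right_mono) (simp_all add: nrm_nonneg cl smult_closed)
      also have "\<dots> < \<epsilon>"
        using elim by (simp add: pos_less_divide_eq add_nonneg_pos mult.commute)
      finally show ?case .
    qed
    then show "\<exists>c. \<forall>\<^sub>F n in sequentially. nrm A (\<Psi> n (b \<odot> x) \<ominus> c \<odot> \<one>) < \<epsilon>" ..
  next
    fix X x and \<epsilon> :: real
    assume x: "x \<in> carrier A" and \<epsilon>: "0 < \<epsilon>"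
      and X: "\<And>m. X m \<in> {x \<in> carrier A. \<forall>\<epsilon>>0. \<exists>c.
        \<forall>\<^sub>F n in sequentially. nrm A (\<Psi> n x \<ominus> c \<odot> \<one>) < \<epsilon>}"
      and lim: "(\<lambda>m. nrm A (X m \<ominus> x)) \<longlonglongrightarrow> 0"
    have "\<forall>\<^sub>F m in sequentially. nrm A (X m \<ominus> x) < \<epsilon> / 2"
      using order_tendstoD(2) [OF lim, of "\<epsilon> / 2"] \<epsilon> by simp
    then obtain m where m: "nrm A (X m \<ominus> x) < \<epsilon> / 2"
      by (meson eventually_happens' sequentially_bot)
    have Xm: "X m \<in> carrier A" using X by blast
    obtain c where c: "\<forall>\<^sub>F n in sequentially. nrm A (\<Psi> n (X m) \<ominus> c \<odot> \<one>) < \<epsilon> / 2"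
      using X [of m] \<epsilon> half_gt_zero by blast
    have "\<forall>\<^sub>F n in sequentially. nrm A (\<Psi> n x \<ominus> c \<odot> \<one>) < \<epsilon>"
      using c
    proof eventually_elim
      case (elim n)
      have "nrm A (\<Psi> n x \<ominus> c \<odot> \<one>) \<le> nrm A (\<Psi> n x \<ominus> \<Psi> n (X m)) + nrm A (\<Psi> n (X m) \<ominus> c \<odot> \<one>)"
        using x Xm by (intro nrm_diff_trans) (simp_all add: cl smult_closed)
      moreover have "nrm A (\<Psi> n x \<ominus> \<Psi> n (X m)) \<le> nrm A (X m \<ominus> x)"
        using bound [OF x Xm, of n] nrm_diff_commute [OF x Xm] by simp
      ultimately show ?case using m elim by simp
    qed
    then show "\<exists>c. \<forall>\<^sub>F n in sequentially. nrm A (\<Psi> n x \<ominus> c \<odot> \<one>) < \<epsilon>" ..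
  qed (auto simp: smult_closed)
qed

section \<open>The 2-adic relations and their monomials\<close>

lemma pow_commute:
  assumes "x \<in> carrier A"
  shows "x \<otimes> x [^] (n::nat) = x [^] n \<otimes> x"
    and "y \<in> carrier A \<Longrightarrow> x \<otimes> (x [^] n \<otimes> y) = x [^] n \<otimes> (x \<otimes> y)"
  using nat_pow_Suc2 [OF assms, of n] assms by (simp_all add: m_assoc [symmetric])

lemma star_pow: "x \<in> carrier A \<Longrightarrow> (x [^] (n::nat))\<^sup>\<star> = x\<^sup>\<star> [^] n"
  by (induction n) (simp_all add: star_simps pow_commute)

lemma isometry_mult:
  assumes "x \<in> carrier A" "y \<in> carrier A" "x\<^sup>\<star> \<otimes> x = \<one>" "y\<^sup>\<star> \<otimes> y = \<one>"
  shows "(x \<otimes> y)\<^sup>\<star> \<otimes> (x \<otimes> y) = \<one>"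
proof -
  have "(x \<otimes> y)\<^sup>\<star> \<otimes> (x \<otimes> y) = y\<^sup>\<star> \<otimes> (x\<^sup>\<star> \<otimes> x) \<otimes> y"
    using assms(1,2) by (simp add: star_simps m_assoc)
  then show ?thesis using assms by (simp add: star_closed)
qed

lemma isometry_pow:
  assumes "x \<in> carrier A" "x\<^sup>\<star> \<otimes> x = \<one>"
  shows "(x [^] (n::nat))\<^sup>\<star> \<otimes> x [^] n = \<one>"
  by (induction n) (use assms in \<open>simp_all add: star_one isometry_mult del: star_mult\<close>)

end

definition half_sqrt :: complex where
  "half_sqrt = complex_of_real (1 / sqrt 2)"

lemma half_sqrt_simps:
  "cnj half_sqrt = half_sqrt" "half_sqrt * half_sqrt = 1 / 2" "cmod half_sqrt = 1 / sqrt 2"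
proof -
  have "1 / sqrt 2 * (1 / sqrt 2) = (1 / 2 :: real)" by simp
  then show "half_sqrt * half_sqrt = 1 / 2"
    unfolding half_sqrt_def of_real_mult [symmetric] by simp
qed (simp_all add: half_sqrt_def norm_divide)

locale two_adic_pair = unital_cstar_algebra A for A (structure) +
  fixes U S
  assumes relations: "two_adic_relations A U S"
begin

lemma U_closed: "U \<in> carrier A"
  and S_closed: "S \<in> carrier A"
  and star_U_U: "U\<^sup>\<star> \<otimes> U = \<one>"
  and U_star_U: "U \<otimes> U\<^sup>\<star> = \<one>"
  and star_S_S: "S\<^sup>\<star> \<otimes> S = \<one>"
  and S_U: "S \<otimes> U = U \<otimes> (U \<otimes> S)"
  and range_sum: "S \<otimes> S\<^sup>\<star> \<oplus> U \<otimes> S \<otimes> S\<^sup>\<star> \<otimes> U\<^sup>\<star> = \<one>"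
  using relations unfolding two_adic_relations_def is_unitary_def is_isometry_def
  by (auto simp: numeral_2_eq_2 m_assoc)

lemmas generators_closed = U_closed S_closed star_closed [OF U_closed] star_closed [OF S_closed]

lemma cancel:
  assumes "x \<in> carrier A"
  shows "U\<^sup>\<star> \<otimes> (U \<otimes> x) = x" "U \<otimes> (U\<^sup>\<star> \<otimes> x) = x" "S\<^sup>\<star> \<otimes> (S \<otimes> x) = x"
  using assms generators_closed
  by (simp_all add: m_assoc [symmetric] star_U_U U_star_U star_S_S)

text \<open>
  Multiplying the sum of the two range projections by \<open>S*\<close> on the left and \<open>U S\<close> on the right gives
  \<open>p = p + p\<close> for \<open>p = S* U S\<close>: the two ranges are orthogonal.
\<close>

lemma star_S_U_S: "S\<^sup>\<star> \<otimes> (U \<otimes> S) = \<zero>"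
proof -
  let ?p = "S\<^sup>\<star> \<otimes> (U \<otimes> S)"
  have "?p = S\<^sup>\<star> \<otimes> (S \<otimes> S\<^sup>\<star> \<oplus> U \<otimes> S \<otimes> S\<^sup>\<star> \<otimes> U\<^sup>\<star>) \<otimes> (U \<otimes> S)"
    using generators_closed by (simp add: range_sum)
  also have "\<dots> = ?p \<oplus> ?p"
    using generators_closed
    by (simp add: r_distr l_distr m_assoc cancel star_S_S)
  finally show ?thesis using generators_closed by simp
qed

lemma star_S_star_U_S: "S\<^sup>\<star> \<otimes> (U\<^sup>\<star> \<otimes> S) = \<zero>"
proof -
  have "S\<^sup>\<star> \<otimes> (U\<^sup>\<star> \<otimes> S) = (S\<^sup>\<star> \<otimes> (U \<otimes> S))\<^sup>\<star>"
    using generators_closed by (simp add: star_simps m_assoc)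
  then show ?thesis by (simp add: star_S_U_S star_zero)
qed

lemma star_S_U_U: "S\<^sup>\<star> \<otimes> (U \<otimes> U) = U \<otimes> S\<^sup>\<star>"
proof -
  have "(S \<otimes> U)\<^sup>\<star> = (U \<otimes> (U \<otimes> S))\<^sup>\<star>" by (simp add: S_U)
  then have *: "U\<^sup>\<star> \<otimes> S\<^sup>\<star> = S\<^sup>\<star> \<otimes> (U\<^sup>\<star> \<otimes> U\<^sup>\<star>)"
    using generators_closed by (simp add: star_mult m_assoc)
  have "S\<^sup>\<star> \<otimes> (U \<otimes> U) = U \<otimes> (U\<^sup>\<star> \<otimes> S\<^sup>\<star>) \<otimes> (U \<otimes> U)"
    using generators_closed by (simp add: cancel)
  also have "\<dots> = U \<otimes> S\<^sup>\<star>"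
    unfolding * using generators_closed by (simp add: m_assoc cancel star_U_U)
  finally show ?thesis .
qed

lemma S_star_U: "S \<otimes> U\<^sup>\<star> = U\<^sup>\<star> \<otimes> (U\<^sup>\<star> \<otimes> S)"
proof -
  have "S \<otimes> U\<^sup>\<star> = U\<^sup>\<star> \<otimes> (U\<^sup>\<star> \<otimes> (S \<otimes> U)) \<otimes> U\<^sup>\<star>"
    unfolding S_U using generators_closed by (simp add: cancel)
  then show ?thesis using generators_closed by (simp add: m_assoc U_star_U)
qed

text \<open>
  The integer powers of \<open>U\<close>. They grow on the right, so that a factor \<open>S\<close> or \<open>S*\<close> standing on the left
  has already been moved through \<open>x\<close>, by the induction hypothesis, when it meets the last \<open>U\<close>.
\<close>

inductive_set upowers :: "'a set" where
  one: "\<one> \<in> upowers"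
| mult_U: "x \<in> upowers \<Longrightarrow> x \<otimes> U \<in> upowers"
| mult_star_U: "x \<in> upowers \<Longrightarrow> x \<otimes> U\<^sup>\<star> \<in> upowers"

lemma upowers_closed: "x \<in> upowers \<Longrightarrow> x \<in> carrier A"
  by (induction rule: upowers.induct) (simp_all add: generators_closed)

lemma upowers_mult_left:
  assumes "x \<in> upowers"
  shows "U \<otimes> x \<in> upowers" "U\<^sup>\<star> \<otimes> x \<in> upowers"
proof -
  have base: "U \<in> upowers" "U\<^sup>\<star> \<in> upowers"
    using upowers.mult_U [OF upowers.one] upowers.mult_star_U [OF upowers.one]
    by (simp_all add: generators_closed)
  show "U \<otimes> x \<in> upowers" "U\<^sup>\<star> \<otimes> x \<in> upowers"
    using assms
    by (induction rule: upowers.induct)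
      (auto simp: base generators_closed upowers_closed m_assoc [symmetric]
        intro: upowers.mult_U upowers.mult_star_U)
qed

lemma upowers_mult: "y \<in> upowers \<Longrightarrow> x \<in> upowers \<Longrightarrow> x \<otimes> y \<in> upowers"
  by (induction rule: upowers.induct)
    (auto simp: generators_closed upowers_closed m_assoc [symmetric]
      intro: upowers.mult_U upowers.mult_star_U)

lemma upowers_star: "x \<in> upowers \<Longrightarrow> x\<^sup>\<star> \<in> upowers"
  by (induction rule: upowers.induct)
    (simp_all add: star_simps upowers_closed generators_closed upowers.one upowers_mult_left)

lemma upowers_isometry: "x \<in> upowers \<Longrightarrow> x\<^sup>\<star> \<otimes> x = \<one>"
  by (induction rule: upowers.induct)
    (simp_all add: isometry_mult star_simps upowers_closed generators_closed star_U_U U_star_U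
      del: star_mult)

lemma upowers_nrm: "x \<in> upowers \<Longrightarrow> nrm A x \<le> 1"
  by (simp add: nrm_isometry_le upowers_closed upowers_isometry)

lemma S_upowers: "x \<in> upowers \<Longrightarrow> \<exists>y\<in>upowers. S \<otimes> x = y \<otimes> S"
proof (induction rule: upowers.induct)
  case one
  show ?case using upowers.one by (intro bexI [of _ \<one>]) (simp_all add: generators_closed)
next
  case (mult_U x)
  then obtain y where y: "y \<in> upowers" "S \<otimes> x = y \<otimes> S" by blast
  have "S \<otimes> (x \<otimes> U) = y \<otimes> (S \<otimes> U)"
    using mult_U y generators_closed upowers_closed by (simp add: m_assoc [symmetric])
  also have "\<dots> = y \<otimes> U \<otimes> U \<otimes> S"
    using y generators_closed upowers_closed by (simp add: m_assoc S_U)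
  finally show ?case using y by (blast intro: upowers.intros)
next
  case (mult_star_U x)
  then obtain y where y: "y \<in> upowers" "S \<otimes> x = y \<otimes> S" by blast
  have "S \<otimes> (x \<otimes> U\<^sup>\<star>) = y \<otimes> (S \<otimes> U\<^sup>\<star>)"
    using mult_star_U y generators_closed upowers_closed by (simp add: m_assoc [symmetric])
  also have "\<dots> = y \<otimes> U\<^sup>\<star> \<otimes> U\<^sup>\<star> \<otimes> S"
    using y generators_closed upowers_closed by (simp add: m_assoc S_star_U)
  finally show ?case using y by (blast intro: upowers.intros)
qed

lemma upowers_star_S:
  assumes "x \<in> upowers"
  shows "\<exists>y\<in>upowers. x \<otimes> S\<^sup>\<star> = S\<^sup>\<star> \<otimes> y"
proof -
  obtain y where y: "y \<in> upowers" "S \<otimes> x\<^sup>\<star> = y \<otimes> S"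
    using S_upowers [OF upowers_star [OF assms]] by blast
  have "x \<otimes> S\<^sup>\<star> = (S \<otimes> x\<^sup>\<star>)\<^sup>\<star>"
    using assms by (simp add: star_simps upowers_closed generators_closed)
  also have "\<dots> = S\<^sup>\<star> \<otimes> y\<^sup>\<star>"
    using y by (simp add: star_simps upowers_closed generators_closed)
  finally show ?thesis using upowers_star [OF y(1)] by blast
qed

lemma upowers_star_S_pow:
  "x \<in> upowers \<Longrightarrow> \<exists>y\<in>upowers. x \<otimes> S\<^sup>\<star> [^] (m::nat) = S\<^sup>\<star> [^] m \<otimes> y"
proof (induction m)
  case 0
  then show ?case by (auto simp: upowers_closed)
next
  case (Suc m)
  then obtain y where y: "y \<in> upowers" "x \<otimes> S\<^sup>\<star> [^] m = S\<^sup>\<star> [^] m \<otimes> y" by blast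
  obtain z where z: "z \<in> upowers" "y \<otimes> S\<^sup>\<star> = S\<^sup>\<star> \<otimes> z" using upowers_star_S [OF y(1)] by blast
  have "x \<otimes> S\<^sup>\<star> [^] Suc m = S\<^sup>\<star> [^] m \<otimes> (y \<otimes> S\<^sup>\<star>)"
    using y Suc.prems by (simp add: m_assoc [symmetric] upowers_closed generators_closed)
  also have "\<dots> = S\<^sup>\<star> [^] Suc m \<otimes> z"
    using z by (simp add: m_assoc upowers_closed generators_closed)
  finally show ?case using z by blast
qed

text \<open>
  \<open>S* U^(2k) = U^k S*\<close> and \<open>S* U^(2k+1) = U^k S* U\<close>; the alternatives correspond to the parity of the
  exponent, and the second one is annihilated by a further factor \<open>S\<close> on the right.
\<close>

lemma star_S_upowers:
  "x \<in> upowers \<Longrightarrow> \<exists>y\<in>upowers. S\<^sup>\<star> \<otimes> x = y \<otimes> S\<^sup>\<star> \<or> S\<^sup>\<star> \<otimes> x = y \<otimes> S\<^sup>\<star> \<otimes> U"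
proof (induction rule: upowers.induct)
  case one
  show ?case using upowers.one by (intro bexI [of _ \<one>]) (simp_all add: generators_closed)
next
  case (mult_U x)
  then obtain y where y: "y \<in> upowers" "S\<^sup>\<star> \<otimes> x = y \<otimes> S\<^sup>\<star> \<or> S\<^sup>\<star> \<otimes> x = y \<otimes> S\<^sup>\<star> \<otimes> U"
    by blast
  note cl = upowers_closed [OF mult_U.hyps] upowers_closed [OF y(1)] generators_closed
  from y(2) show ?case
  proof
    assume "S\<^sup>\<star> \<otimes> x = y \<otimes> S\<^sup>\<star>"
    then have "S\<^sup>\<star> \<otimes> (x \<otimes> U) = y \<otimes> S\<^sup>\<star> \<otimes> U" using cl by (simp add: m_assoc [symmetric])
    then show ?thesis using y(1) by blast
  next
    assume "S\<^sup>\<star> \<otimes> x = y \<otimes> S\<^sup>\<star> \<otimes> U"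
    then have "S\<^sup>\<star> \<otimes> (x \<otimes> U) = y \<otimes> S\<^sup>\<star> \<otimes> U \<otimes> U" using cl by (simp add: m_assoc [symmetric])
    also have "\<dots> = y \<otimes> U \<otimes> S\<^sup>\<star>" using cl by (simp add: m_assoc star_S_U_U)
    finally show ?thesis using upowers.mult_U [OF y(1)] by blast
  qed
next
  case (mult_star_U x)
  then obtain y where y: "y \<in> upowers" "S\<^sup>\<star> \<otimes> x = y \<otimes> S\<^sup>\<star> \<or> S\<^sup>\<star> \<otimes> x = y \<otimes> S\<^sup>\<star> \<otimes> U"
    by blast
  note cl = upowers_closed [OF mult_star_U.hyps] upowers_closed [OF y(1)] generators_closed
  from y(2) show ?case
  proof
    assume "S\<^sup>\<star> \<otimes> x = y \<otimes> S\<^sup>\<star>"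
    then have "S\<^sup>\<star> \<otimes> (x \<otimes> U\<^sup>\<star>) = y \<otimes> (U\<^sup>\<star> \<otimes> (U \<otimes> S\<^sup>\<star>)) \<otimes> U\<^sup>\<star>"
      using cl by (simp add: m_assoc [symmetric] star_U_U)
    also have "\<dots> = y \<otimes> U\<^sup>\<star> \<otimes> S\<^sup>\<star> \<otimes> U"
      unfolding star_S_U_U [symmetric] using cl by (simp add: m_assoc U_star_U)
    finally show ?thesis using upowers.mult_star_U [OF y(1)] by blast
  next
    assume "S\<^sup>\<star> \<otimes> x = y \<otimes> S\<^sup>\<star> \<otimes> U"
    then have "S\<^sup>\<star> \<otimes> (x \<otimes> U\<^sup>\<star>) = y \<otimes> S\<^sup>\<star> \<otimes> U \<otimes> U\<^sup>\<star>" using cl by (simp add: m_assoc [symmetric])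
    also have "\<dots> = y \<otimes> S\<^sup>\<star>" using cl by (simp add: m_assoc U_star_U)
    finally show ?thesis using y(1) by blast
  qed
qed

definition monomials :: "'a set" where
  "monomials = {x \<otimes> S [^] n \<otimes> S\<^sup>\<star> [^] m \<otimes> y | x y (n::nat) (m::nat). x \<in> upowers \<and> y \<in> upowers}"

lemma monomialsI:
  "x \<in> upowers \<Longrightarrow> y \<in> upowers \<Longrightarrow> x \<otimes> S [^] (n::nat) \<otimes> S\<^sup>\<star> [^] (m::nat) \<otimes> y \<in> monomials"
  unfolding monomials_def by blast

lemma monomials_closed: "monomials \<subseteq> carrier A"
  unfolding monomials_def by (auto simp: upowers_closed generators_closed)

lemma monomials_left_mult:
  assumes "t \<in> monomials"
  shows "U \<otimes> t \<in> monomials" "U\<^sup>\<star> \<otimes> t \<in> monomials" "S \<otimes> t \<in> monomials"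
    "S\<^sup>\<star> \<otimes> t \<in> insert \<zero> monomials"
proof -
  obtain x y n m where t: "t = x \<otimes> S [^] (n::nat) \<otimes> S\<^sup>\<star> [^] (m::nat) \<otimes> y"
    and xy: "x \<in> upowers" "y \<in> upowers"
    using assms unfolding monomials_def by blast
  note cl = generators_closed upowers_closed [OF xy(1)] upowers_closed [OF xy(2)]
  have "U \<otimes> t = (U \<otimes> x) \<otimes> S [^] n \<otimes> S\<^sup>\<star> [^] m \<otimes> y"
    "U\<^sup>\<star> \<otimes> t = (U\<^sup>\<star> \<otimes> x) \<otimes> S [^] n \<otimes> S\<^sup>\<star> [^] m \<otimes> y"
    unfolding t using cl by (simp_all add: m_assoc)
  then show "U \<otimes> t \<in> monomials" "U\<^sup>\<star> \<otimes> t \<in> monomials"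
    using xy by (auto intro!: monomialsI upowers_mult_left)
  obtain x' where x': "x' \<in> upowers" "S \<otimes> x = x' \<otimes> S" using S_upowers [OF xy(1)] by blast
  have "S \<otimes> t = (S \<otimes> x) \<otimes> S [^] n \<otimes> S\<^sup>\<star> [^] m \<otimes> y"
    unfolding t using cl by (simp add: m_assoc)
  also have "\<dots> = x' \<otimes> S [^] Suc n \<otimes> S\<^sup>\<star> [^] m \<otimes> y"
    unfolding x' using cl upowers_closed [OF x'(1)]
    by (simp add: m_assoc pow_commute)
  finally show "S \<otimes> t \<in> monomials" using monomialsI [OF x'(1) xy(2), of "Suc n" m] by simp
  show "S\<^sup>\<star> \<otimes> t \<in> insert \<zero> monomials"
  proof (cases n)
    case 0
    obtain z where z: "z \<in> upowers" "x \<otimes> S\<^sup>\<star> [^] m = S\<^sup>\<star> [^] m \<otimes> z"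
      using upowers_star_S_pow [OF xy(1)] by blast
    have "S\<^sup>\<star> \<otimes> t = S\<^sup>\<star> \<otimes> (x \<otimes> S\<^sup>\<star> [^] m) \<otimes> y"
      unfolding t 0 using cl by (simp add: m_assoc)
    also have "\<dots> = \<one> \<otimes> S [^] (0::nat) \<otimes> S\<^sup>\<star> [^] Suc m \<otimes> (z \<otimes> y)"
      unfolding z using cl upowers_closed [OF z(1)]
      by (simp add: m_assoc pow_commute)
    finally show ?thesis
      using monomialsI [OF upowers.one upowers_mult [OF xy(2) z(1)], of 0 "Suc m"] by simp
  next
    case (Suc k)
    obtain z where z: "z \<in> upowers" "S\<^sup>\<star> \<otimes> x = z \<otimes> S\<^sup>\<star> \<or> S\<^sup>\<star> \<otimes> x = z \<otimes> S\<^sup>\<star> \<otimes> U"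
      using star_S_upowers [OF xy(1)] by blast
    note cl = cl upowers_closed [OF z(1)]
    have t': "S\<^sup>\<star> \<otimes> t = (S\<^sup>\<star> \<otimes> x) \<otimes> S \<otimes> S [^] k \<otimes> S\<^sup>\<star> [^] m \<otimes> y"
      unfolding t Suc using cl by (simp add: m_assoc pow_commute)
    from z(2) show ?thesis
    proof
      assume "S\<^sup>\<star> \<otimes> x = z \<otimes> S\<^sup>\<star>"
      then have "S\<^sup>\<star> \<otimes> t = z \<otimes> S [^] k \<otimes> S\<^sup>\<star> [^] m \<otimes> y"
        unfolding t' using cl by (simp add: m_assoc star_S_S cancel)
      then show ?thesis using monomialsI [OF z(1) xy(2)] by simp
    next
      assume "S\<^sup>\<star> \<otimes> x = z \<otimes> S\<^sup>\<star> \<otimes> U"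
      then have "S\<^sup>\<star> \<otimes> t = z \<otimes> (S\<^sup>\<star> \<otimes> (U \<otimes> S)) \<otimes> S [^] k \<otimes> S\<^sup>\<star> [^] m \<otimes> y"
        unfolding t' using cl by (simp add: m_assoc)
      then show ?thesis using cl by (simp add: star_S_U_S)
    qed
  qed
qed

text \<open>
  By left invariance it is enough that a generator or its adjoint times a monomial is a monomial or
  zero.
\<close>

theorem closed_span_monomials:
  assumes "cstar_generated_by A {U, S}"
  shows "closed_span monomials = carrier A"
proof (rule left_invariant_closed_subspace_eq_carrier [OF assms])
  note E = closed_subspace_closed_span [OF monomials_closed]
  show "closed_subspace (closed_span monomials)" by (rule E)
  have "\<one> \<in> monomials"
    using monomialsI [OF upowers.one upowers.one, of 0 0] by simp
  then show "\<one> \<in> closed_span monomials" using closed_span_superset by blast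
  have *: "g \<otimes> x \<in> closed_span monomials"
    if g: "g \<in> carrier A" and gt: "\<And>t. t \<in> monomials \<Longrightarrow> g \<otimes> t \<in> insert \<zero> monomials"
      and x: "x \<in> closed_span monomials" for g x
  proof -
    have sub: "insert \<zero> monomials \<subseteq> closed_span monomials"
      using closed_span_superset closed_subspaceD(2) [OF E] by simp
    have "monomials \<subseteq> {x \<in> carrier A. g \<otimes> x \<in> closed_span monomials}"
    proof
      fix t assume "t \<in> monomials"
      then show "t \<in> {x \<in> carrier A. g \<otimes> x \<in> closed_span monomials}"
        using subsetD [OF sub gt] monomials_closed by blast
    qed
    then show ?thesis
      using closed_span_minimal [OF closed_subspace_left_preimage [OF E g]] x by blast
  qed
  show "g \<otimes> x \<in> closed_span monomials \<and> g\<^sup>\<star> \<otimes> x \<in> closed_span monomials"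
    if "g \<in> {U, S}" "x \<in> closed_span monomials" for g x
    using that monomials_left_mult by (auto intro!: * simp: generators_closed)
qed


section \<open>The averaging and differencing isometries\<close>

text \<open>
  In the canonical representation on the sequences indexed by the integers (\<open>U\<close> shifts by one, \<open>S\<close>
  doubles the index), \<open>R\<close> spreads each entry evenly over a pair of neighbours and \<open>Q\<close> does the same
  with opposite signs: these are the low-pass and the high-pass filter of the Haar wavelet.
\<close>

definition R :: 'a where "R = half_sqrt \<odot> (U \<otimes> S \<oplus> S)"

definition Q :: 'a where "Q = half_sqrt \<odot> (U \<otimes> S \<ominus> S)"

lemma RQ_closed: "R \<in> carrier A" "Q \<in> carrier A"
  by (simp_all add: R_def Q_def smult_closed generators_closed)

lemma star_half_mult_half:
  assumes "x \<in> carrier A" "y \<in> carrier A"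
  shows "(half_sqrt \<odot> x)\<^sup>\<star> \<otimes> (half_sqrt \<odot> y) = (1 / 2) \<odot> (x\<^sup>\<star> \<otimes> y)"
  using assms
  by (simp add: star_smult smult_mult_left smult_mult_right smult_closed star_closed
      half_sqrt_simps smult_smult [symmetric])

lemma half_double: "(1 / 2) \<odot> (\<one> \<oplus> \<one>) = \<one>"
  by (simp add: smult_add_right smult_add_left [symmetric] smult_one)

lemma star_R_R: "R\<^sup>\<star> \<otimes> R = \<one>"
  and star_Q_Q: "Q\<^sup>\<star> \<otimes> Q = \<one>"
  and star_R_Q: "R\<^sup>\<star> \<otimes> Q = \<zero>"
proof -
  have "(U \<otimes> S \<oplus> S)\<^sup>\<star> \<otimes> (U \<otimes> S \<oplus> S) = \<one> \<oplus> \<one>"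
    using generators_closed
    by (simp add: star_simps l_distr r_distr m_assoc cancel star_S_S star_S_U_S star_S_star_U_S)
  then show "R\<^sup>\<star> \<otimes> R = \<one>"
    by (simp add: R_def star_half_mult_half half_double generators_closed)
  have "(U \<otimes> S \<ominus> S)\<^sup>\<star> \<otimes> (U \<otimes> S \<ominus> S) = \<one> \<oplus> \<one>"
    using generators_closed
    by (simp add: star_simps minus_eq l_distr r_distr l_minus r_minus m_assoc cancel
        star_S_S star_S_U_S star_S_star_U_S)
  then show "Q\<^sup>\<star> \<otimes> Q = \<one>"
    by (simp add: Q_def star_half_mult_half half_double generators_closed)
  have "(U \<otimes> S \<oplus> S)\<^sup>\<star> \<otimes> (U \<otimes> S \<ominus> S) = \<zero>"
    using generators_closed
    by (simp add: star_simps minus_eq l_distr r_distr l_minus r_minus m_assoc cancel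
        star_S_S star_S_U_S star_S_star_U_S r_neg)
  then show "R\<^sup>\<star> \<otimes> Q = \<zero>"
    by (simp add: R_def Q_def star_half_mult_half smult_zero_right generators_closed)
qed

lemma star_S_R: "S\<^sup>\<star> \<otimes> R = half_sqrt \<odot> \<one>"
  using generators_closed
  by (simp add: R_def smult_mult_right r_distr star_S_S star_S_U_S)

lemma U_minus_one_R: "(U \<ominus> \<one>) \<otimes> R = half_sqrt \<odot> (S \<otimes> (U \<ominus> \<one>))"
proof -
  have "(U \<ominus> \<one>) \<otimes> (U \<otimes> S \<oplus> S) = U \<otimes> (U \<otimes> S) \<ominus> S"
    using generators_closed(1,2) by algebra
  also have "\<dots> = S \<otimes> (U \<ominus> \<one>)"
    unfolding S_U [symmetric] using generators_closed by (simp add: minus_eq r_distr r_minus)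
  finally show ?thesis
    using generators_closed by (simp add: R_def smult_mult_right)
qed

text \<open>
  Each factor \<open>R\<close> that \<open>U - 1\<close> passes turns into \<open>S / sqrt 2\<close>. Hence the vectors in the range of
  \<open>R^n\<close> are almost invariant under \<open>U\<close>, with an error that decays geometrically.
\<close>

lemma U_R_pow:
  "U \<otimes> R [^] (n::nat) \<ominus> R [^] n = half_sqrt ^ n \<odot> (S [^] n \<otimes> (U \<ominus> \<one>))"
proof (induction n)
  case 0
  show ?case using generators_closed by (simp add: smult_one)
next
  case (Suc n)
  note cl = generators_closed RQ_closed
  have "U \<otimes> R [^] Suc n \<ominus> R [^] Suc n = (U \<otimes> R [^] n \<ominus> R [^] n) \<otimes> R"
    using cl by (simp add: minus_eq l_distr l_minus m_assoc)
  also have "\<dots> = half_sqrt ^ n \<odot> (S [^] n \<otimes> ((U \<ominus> \<one>) \<otimes> R))"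
    unfolding Suc.IH using cl by (simp add: smult_mult_left m_assoc)
  also have "\<dots> = half_sqrt ^ Suc n \<odot> (S [^] Suc n \<otimes> (U \<ominus> \<one>))"
    unfolding U_minus_one_R using cl
    by (simp add: smult_mult_right smult_smult [symmetric] smult_closed m_assoc mult.commute)
  finally show ?case .
qed

text \<open>
  In the same representation, \<open>K n\<close> maps the unit vectors to the Haar wavelets of scale \<open>n\<close>.
\<close>

definition K :: "nat \<Rightarrow> 'a" where "K n = R [^] n \<otimes> Q"

lemma K_closed: "K n \<in> carrier A"
  by (simp add: K_def RQ_closed)

lemma star_R_pow_add:
  "(R [^] n)\<^sup>\<star> \<otimes> R [^] (n + k :: nat) = R [^] k"
proof -
  have "(R [^] n)\<^sup>\<star> \<otimes> R [^] (n + k) = ((R [^] n)\<^sup>\<star> \<otimes> R [^] n) \<otimes> R [^] k"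
    by (simp add: RQ_closed star_closed m_assoc nat_pow_mult)
  then show ?thesis by (simp add: isometry_pow RQ_closed star_R_R)
qed

lemma star_K_K: "(K i)\<^sup>\<star> \<otimes> K j = (if i = j then \<one> else \<zero>)"
proof -
  have less: "(K i)\<^sup>\<star> \<otimes> K j = \<zero>" if "i > j" for i j
  proof -
    obtain k where i: "i = j + Suc k" using \<open>i > j\<close> less_iff_Suc_add by auto
    have "(K j)\<^sup>\<star> \<otimes> K i = Q\<^sup>\<star> \<otimes> ((R [^] j)\<^sup>\<star> \<otimes> R [^] i) \<otimes> Q"
      by (simp add: K_def star_simps RQ_closed m_assoc)
    also have "\<dots> = (R\<^sup>\<star> \<otimes> Q)\<^sup>\<star> \<otimes> (R [^] k \<otimes> Q)"
      unfolding i star_R_pow_add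
      by (simp add: star_simps RQ_closed m_assoc pow_commute)
    finally have "(K j)\<^sup>\<star> \<otimes> K i = \<zero>" by (simp add: star_R_Q star_zero RQ_closed)
    then have "((K j)\<^sup>\<star> \<otimes> K i)\<^sup>\<star> = \<zero>" by (simp add: star_zero)
    then show ?thesis by (simp add: star_simps K_closed)
  qed
  consider "i = j" | "i > j" | "j > i" by linarith
  then show ?thesis
  proof cases
    case 1
    then show ?thesis
      by (simp add: K_def isometry_mult isometry_pow RQ_closed star_R_R star_Q_Q)
  next
    case 3
    then have "((K j)\<^sup>\<star> \<otimes> K i)\<^sup>\<star> = \<zero>" by (simp add: less star_zero)
    then show ?thesis using 3 by (simp add: star_simps K_closed)
  qed (simp add: less)
qed

lemma K_nrm: "nrm A (K n) \<le> 1"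
  by (rule nrm_isometry_le) (simp_all add: K_closed star_K_K)

text \<open>
  Each \<open>S*\<close> lowers the scale by one at the cost of a factor \<open>1 / sqrt 2\<close>, because \<open>S* R\<close> is scalar.
\<close>

lemma star_S_pow_K: "S\<^sup>\<star> [^] m \<otimes> K (m + k) = half_sqrt ^ m \<odot> K k"
proof (induction m)
  case 0
  show ?case by (simp add: K_closed smult_one)
next
  case (Suc m)
  note cl = generators_closed RQ_closed
  have "S\<^sup>\<star> [^] Suc m \<otimes> K (Suc m + k) = S\<^sup>\<star> [^] m \<otimes> (S\<^sup>\<star> \<otimes> R) \<otimes> K (m + k)"
    using cl by (simp add: K_def m_assoc pow_commute)
  also have "\<dots> = half_sqrt \<odot> (S\<^sup>\<star> [^] m \<otimes> K (m + k))"
    unfolding star_S_R using cl K_closed by (simp add: smult_mult_right smult_mult_left)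
  finally show ?case
    by (simp add: Suc.IH smult_smult [symmetric] K_closed)
qed

text \<open>
  Written as an inner product of \<open>S*^n (K N)\<close> and \<open>S*^m (K N)\<close>, the compression compares wavelets of
  the scales \<open>N - n\<close> and \<open>N - m\<close>, which are orthonormal. The bound on \<open>N\<close> keeps both scales
  nonnegative.
\<close>

lemma K_star_monomial_K:
  assumes "n + m \<le> N"
  shows "(K N)\<^sup>\<star> \<otimes> (S [^] n \<otimes> S\<^sup>\<star> [^] m) \<otimes> K N =
    (if n = m then half_sqrt ^ (n + m) else 0) \<odot> \<one>"
proof -
  note cl = generators_closed K_closed
  have shift: "S\<^sup>\<star> [^] i \<otimes> K N = half_sqrt ^ i \<odot> K (N - i)" if "i \<le> N" for i
    using star_S_pow_K [of i "N - i"] that by simp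
  have "(K N)\<^sup>\<star> \<otimes> (S [^] n \<otimes> S\<^sup>\<star> [^] m) \<otimes> K N = (S\<^sup>\<star> [^] n \<otimes> K N)\<^sup>\<star> \<otimes> (S\<^sup>\<star> [^] m \<otimes> K N)"
    using cl by (simp add: star_mult star_pow star_star star_closed m_assoc)
  also have "\<dots> = half_sqrt ^ (n + m) \<odot> ((K (N - n))\<^sup>\<star> \<otimes> K (N - m))"
    using assms cl
    by (simp add: shift star_smult smult_mult_left smult_mult_right smult_closed star_closed
        smult_smult [symmetric] half_sqrt_simps power_add mult.commute)
  also have "\<dots> = (if n = m then half_sqrt ^ (n + m) else 0) \<odot> \<one>"
    using assms by (auto simp: star_K_K smult_zero_left smult_zero_right)
  finally show ?thesis .
qed

section \<open>Compressions become scalar\<close>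

lemma upowers_K_tendsto:
  assumes "x \<in> upowers"
  shows "(\<lambda>n. nrm A (x \<otimes> K n \<ominus> K n)) \<longlonglongrightarrow> 0"
proof -
  have bound: "nrm A (U \<otimes> K n \<ominus> K n) \<le> nrm A (U \<ominus> \<one>) * (1 / sqrt 2) ^ n" for n
  proof -
    have "U \<otimes> K n \<ominus> K n = (U \<otimes> R [^] n \<ominus> R [^] n) \<otimes> Q"
      using generators_closed RQ_closed by (simp add: K_def minus_eq l_distr l_minus m_assoc)
    also have "\<dots> = half_sqrt ^ n \<odot> (S [^] n \<otimes> (U \<ominus> \<one>) \<otimes> Q)"
      unfolding U_R_pow using generators_closed RQ_closed by (simp add: smult_mult_left)
    finally have "nrm A (U \<otimes> K n \<ominus> K n) = (1 / sqrt 2) ^ n * nrm A (S [^] n \<otimes> (U \<ominus> \<one>) \<otimes> Q)"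
      using generators_closed RQ_closed
      by (simp add: nrm_smult norm_power half_sqrt_simps)
    moreover have "nrm A (S [^] n \<otimes> (U \<ominus> \<one>) \<otimes> Q) \<le> (1 * nrm A (U \<ominus> \<one>)) * 1"
      by (intro nrm_mult_le nrm_isometry_le)
        (simp_all add: generators_closed RQ_closed isometry_pow star_S_S star_Q_Q)
    ultimately show ?thesis by (simp add: divide_right_mono mult.commute mult_left_mono)
  qed
  have lim: "(\<lambda>n. nrm A (U \<otimes> K n \<ominus> K n)) \<longlonglongrightarrow> 0"
    by (rule tendsto_zero_bound [OF _ _ bound])
      (simp_all add: LIMSEQ_power_zero nrm_nonneg generators_closed K_closed)
  have lim_star: "(\<lambda>n. nrm A (U\<^sup>\<star> \<otimes> K n \<ominus> K n)) \<longlonglongrightarrow> 0"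
  proof (rule tendsto_zero_bound [OF lim, of _ 1])
    fix n
    have "U\<^sup>\<star> \<otimes> K n \<ominus> K n = U\<^sup>\<star> \<otimes> (K n \<ominus> U \<otimes> K n)"
      using generators_closed K_closed by (simp add: minus_eq r_distr r_minus cancel)
    moreover have "nrm A (U\<^sup>\<star> \<otimes> (K n \<ominus> U \<otimes> K n)) \<le> 1 * nrm A (U \<otimes> K n \<ominus> K n)"
      by (intro nrm_mult_le nrm_isometry_le)
        (simp_all add: generators_closed K_closed star_star U_star_U nrm_diff_commute)
    ultimately show "nrm A (U\<^sup>\<star> \<otimes> K n \<ominus> K n) \<le> 1 * nrm A (U \<otimes> K n \<ominus> K n)" by simp
  qed (simp add: nrm_nonneg generators_closed K_closed)
  have step: "(\<lambda>n. nrm A (x \<otimes> g \<otimes> K n \<ominus> K n)) \<longlonglongrightarrow> 0"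
    if x: "x \<in> upowers" and g: "g \<in> carrier A"
      and l1: "(\<lambda>n. nrm A (x \<otimes> K n \<ominus> K n)) \<longlonglongrightarrow> 0"
      and l2: "(\<lambda>n. nrm A (g \<otimes> K n \<ominus> K n)) \<longlonglongrightarrow> 0" for x g
  proof (rule tendsto_zero_bound [where C = 1])
    show "(\<lambda>n. nrm A (x \<otimes> K n \<ominus> K n) + nrm A (g \<otimes> K n \<ominus> K n)) \<longlonglongrightarrow> 0"
      using tendsto_add [OF l1 l2] by simp
    fix n
    note cl = K_closed [of n] upowers_closed [OF x] g
    have "x \<otimes> g \<otimes> K n \<ominus> K n = x \<otimes> (g \<otimes> K n \<ominus> K n) \<oplus> (x \<otimes> K n \<ominus> K n)"
      using cl by algebra
    then have "nrm A (x \<otimes> g \<otimes> K n \<ominus> K n)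
        \<le> nrm A (x \<otimes> (g \<otimes> K n \<ominus> K n)) + nrm A (x \<otimes> K n \<ominus> K n)"
      using nrm_triangle [of "x \<otimes> (g \<otimes> K n \<ominus> K n)" "x \<otimes> K n \<ominus> K n"] cl by simp
    moreover have "nrm A (x \<otimes> (g \<otimes> K n \<ominus> K n)) \<le> 1 * nrm A (g \<otimes> K n \<ominus> K n)"
      by (intro nrm_mult_le) (use cl x in \<open>simp_all add: upowers_nrm\<close>)
    ultimately show "nrm A (x \<otimes> g \<otimes> K n \<ominus> K n)
        \<le> 1 * (nrm A (x \<otimes> K n \<ominus> K n) + nrm A (g \<otimes> K n \<ominus> K n))" by simp
    show "0 \<le> nrm A (x \<otimes> g \<otimes> K n \<ominus> K n)" using cl by (simp add: nrm_nonneg)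
  qed
  have diff_zero: "K n \<ominus> K n = \<zero>" for n
    using K_closed by (simp add: minus_eq r_neg)
  show ?thesis
    using assms
    by (induction rule: upowers.induct)
      (simp_all add: step lim lim_star generators_closed K_closed diff_zero nrm_zero)
qed

text \<open>
  In the limit the outer powers of \<open>U\<close> are absorbed by the factors \<open>K N\<close>, and what remains between
  them has an exactly scalar compression.
\<close>

lemma monomials_eventually_scalar:
  assumes "t \<in> monomials" "0 < \<epsilon>"
  shows "\<exists>c. \<forall>\<^sub>F N in sequentially. nrm A ((K N)\<^sup>\<star> \<otimes> t \<otimes> K N \<ominus> c \<odot> \<one>) < \<epsilon>"
proof -
  obtain x y n m where t: "t = x \<otimes> S [^] (n::nat) \<otimes> S\<^sup>\<star> [^] (m::nat) \<otimes> y"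
    and xy: "x \<in> upowers" "y \<in> upowers"
    using assms(1) unfolding monomials_def by blast
  \<comment> \<open>The limit scalar \<open>c\<close> is the exact compression of the core \<open>C\<close> at every large scale.\<close>
  define C where "C = S [^] n \<otimes> S\<^sup>\<star> [^] m"
  define c where "c = (if n = m then half_sqrt ^ (n + m) else 0)"
  have S_nrm: "nrm A (S [^] i) \<le> 1" for i :: nat
    by (simp add: nrm_isometry_le isometry_pow S_closed star_S_S)
  have C_closed: "C \<in> carrier A" by (simp add: C_def generators_closed)
  have "nrm A C \<le> 1 * 1"
    unfolding C_def star_pow [OF S_closed, symmetric]
    by (intro nrm_mult_le) (simp_all add: generators_closed S_nrm nrm_star star_closed)
  then have C_nrm: "nrm A C \<le> 1" by simp
  have t_eq: "t = x \<otimes> C \<otimes> y"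
    unfolding t C_def using xy by (simp add: m_assoc generators_closed upowers_closed)
  have "(\<lambda>N. nrm A (x\<^sup>\<star> \<otimes> K N \<ominus> K N) + nrm A (y \<otimes> K N \<ominus> K N)) \<longlonglongrightarrow> 0"
    using tendsto_add [OF upowers_K_tendsto [OF upowers_star [OF xy(1)]]
        upowers_K_tendsto [OF xy(2)]] by simp
  then have "\<forall>\<^sub>F N in sequentially. nrm A (x\<^sup>\<star> \<otimes> K N \<ominus> K N) + nrm A (y \<otimes> K N \<ominus> K N) < \<epsilon>"
    using assms(2) by (simp add: order_tendstoD(2))
  moreover have "\<forall>\<^sub>F N in sequentially. n + m \<le> N"
    by (rule eventually_ge_at_top)
  ultimately have "\<forall>\<^sub>F N in sequentially. nrm A ((K N)\<^sup>\<star> \<otimes> t \<otimes> K N \<ominus> c \<odot> \<one>) < \<epsilon>"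
  proof eventually_elim
    case (elim N)
    note cl = K_closed [of N] star_closed [OF K_closed, of N] C_closed
      upowers_closed [OF xy(1)] upowers_closed [OF xy(2)]
    let ?d = "(x\<^sup>\<star> \<otimes> K N \<ominus> K N)\<^sup>\<star>" and ?e = "y \<otimes> K N \<ominus> K N"
    have d: "?d = (K N)\<^sup>\<star> \<otimes> x \<ominus> (K N)\<^sup>\<star>" using cl by (simp add: star_simps)
    have "c \<odot> \<one> = (K N)\<^sup>\<star> \<otimes> C \<otimes> K N"
      using K_star_monomial_K [OF elim(2)] by (simp add: C_def c_def)
    then have "(K N)\<^sup>\<star> \<otimes> t \<otimes> K N \<ominus> c \<odot> \<one> =
        (K N)\<^sup>\<star> \<otimes> (x \<otimes> C \<otimes> y) \<otimes> K N \<ominus> (K N)\<^sup>\<star> \<otimes> C \<otimes> K N"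
      unfolding t_eq by simp
    also have "\<dots> = (K N)\<^sup>\<star> \<otimes> x \<otimes> C \<otimes> ?e \<oplus> ?d \<otimes> C \<otimes> K N"
      unfolding d using cl by algebra
    finally have "nrm A ((K N)\<^sup>\<star> \<otimes> t \<otimes> K N \<ominus> c \<odot> \<one>)
        \<le> nrm A ((K N)\<^sup>\<star> \<otimes> x \<otimes> C \<otimes> ?e) + nrm A (?d \<otimes> C \<otimes> K N)"
      using nrm_triangle [of "(K N)\<^sup>\<star> \<otimes> x \<otimes> C \<otimes> ?e" "?d \<otimes> C \<otimes> K N"] cl
      by (simp add: star_closed)
    moreover have "nrm A ((K N)\<^sup>\<star> \<otimes> x \<otimes> C \<otimes> ?e) \<le> ((1 * 1) * 1) * nrm A ?e"
      by (intro nrm_mult_le)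
        (use cl xy in \<open>simp_all add: K_nrm nrm_star upowers_nrm C_nrm star_closed\<close>)
    moreover have "nrm A (?d \<otimes> C \<otimes> K N) \<le> (nrm A (x\<^sup>\<star> \<otimes> K N \<ominus> K N) * 1) * 1"
      by (intro nrm_mult_le)
        (use cl in \<open>simp_all add: K_nrm nrm_star C_nrm star_closed\<close>)
    ultimately show ?case using elim(1) by simp
  qed
  then show ?thesis ..
qed

theorem eventually_scalar:
  assumes "cstar_generated_by A {U, S}" "x \<in> carrier A" "0 < \<epsilon>"
  shows "\<exists>c. \<forall>\<^sub>F N in sequentially. nrm A ((K N)\<^sup>\<star> \<otimes> x \<otimes> K N \<ominus> c \<odot> \<one>) < \<epsilon>"
proof -
  have "monomials \<subseteq> {x \<in> carrier A. \<forall>\<epsilon>>0. \<exists>c.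
      \<forall>\<^sub>F N in sequentially. nrm A ((K N)\<^sup>\<star> \<otimes> x \<otimes> K N \<ominus> c \<odot> \<one>) < \<epsilon>}"
    using monomials_closed monomials_eventually_scalar by blast
  from closed_span_minimal [OF closed_subspace_eventually_scalar [OF K_closed K_nrm] this]
  show ?thesis unfolding closed_span_monomials [OF assms(1)] using assms(2,3) by blast
qed

text \<open>
  \<open>W\<close> passes through the factors \<open>R\<close> unchanged and turns \<open>Q\<close> into \<open>Q P\<close>, so \<open>W (K N) = (K N) P\<close>.
\<close>

lemma K_star_intertwiner_K:
  assumes "W \<in> carrier A" "P \<in> carrier A" "W \<otimes> R = R \<otimes> W" "W \<otimes> Q = Q \<otimes> P"
  shows "(K N)\<^sup>\<star> \<otimes> W \<otimes> K N = P"
proof -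
  note cl = assms(1,2) RQ_closed
  have pow: "W \<otimes> R [^] n = R [^] n \<otimes> W" for n :: nat
  proof (induction n)
    case (Suc n)
    have "W \<otimes> R [^] Suc n = (W \<otimes> R [^] n) \<otimes> R" using cl by (simp add: m_assoc)
    also have "\<dots> = R [^] n \<otimes> (W \<otimes> R)" unfolding Suc.IH using cl by (simp add: m_assoc)
    also have "\<dots> = R [^] Suc n \<otimes> W" unfolding assms(3) using cl by (simp add: m_assoc)
    finally show ?case .
  qed (use cl in simp)
  have "W \<otimes> K N = R [^] N \<otimes> (W \<otimes> Q)"
    using cl pow by (simp add: K_def m_assoc [symmetric])
  then have "W \<otimes> K N = K N \<otimes> P" using cl by (simp add: assms(4) K_def m_assoc)
  then have "(K N)\<^sup>\<star> \<otimes> W \<otimes> K N = ((K N)\<^sup>\<star> \<otimes> K N) \<otimes> P"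
    using cl K_closed by (simp add: m_assoc star_closed)
  then show ?thesis using cl by (simp add: star_K_K)
qed

text \<open>
  \<open>P\<close> would have to lie within distance less than 1 of a scalar, although it acts as \<open>1\<close> on one
  isometry and as \<open>-1\<close> on another.
\<close>

theorem no_intertwiner:
  assumes gen: "cstar_generated_by A {U, S}" and nontriv: "\<one> \<noteq> \<zero>"
    and W: "W \<in> carrier A" "W \<otimes> R = R \<otimes> W" "W \<otimes> Q = Q \<otimes> P"
    and P: "P \<in> carrier A" "P \<otimes> (U \<otimes> S) = U \<otimes> S" "P \<otimes> S = \<ominus> S"
  shows False
proof -
  from eventually_scalar [OF gen W(1), of 1] obtain c
    where "\<forall>\<^sub>F N in sequentially. nrm A ((K N)\<^sup>\<star> \<otimes> W \<otimes> K N \<ominus> c \<odot> \<one>) < 1" by auto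
  then have near: "nrm A (P \<ominus> c \<odot> \<one>) < 1"
    by (simp add: K_star_intertwiner_K [OF W(1) P(1) W(2,3)])
  \<comment> \<open>The scalar close to \<open>P\<close> is close to every eigenvalue of \<open>P\<close>, tested on an isometry.\<close>
  have eigen: "cmod (l - c) < 1"
    if s: "s \<in> carrier A" "s\<^sup>\<star> \<otimes> s = \<one>" and ev: "P \<otimes> s = l \<odot> s" for s l
  proof -
    have "(P \<ominus> c \<odot> \<one>) \<otimes> s = l \<odot> s \<ominus> c \<odot> s"
      using s P(1) ev by (simp add: minus_eq l_distr l_minus smult_closed smult_mult_left)
    also have "\<dots> = (l - c) \<odot> s"
      using s(1) smult_add_left [of s l "- c"] smult_smult [of s "-1" c]
      by (simp add: minus_eq smult_minus_one smult_closed)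
    finally have "nrm A ((P \<ominus> c \<odot> \<one>) \<otimes> s) = cmod (l - c)"
      using nrm_isometry [OF s nontriv] s(1) by (simp add: nrm_smult)
    moreover have "nrm A ((P \<ominus> c \<odot> \<one>) \<otimes> s) \<le> nrm A (P \<ominus> c \<odot> \<one>) * 1"
      by (intro nrm_mult_le) (use s P(1) in \<open>simp_all add: smult_closed nrm_isometry_le\<close>)
    ultimately show ?thesis using near by simp
  qed
  have "cmod (1 - c) < 1"
    by (rule eigen [of "U \<otimes> S"])
      (simp_all add: generators_closed isometry_mult star_U_U star_S_S P smult_one)
  moreover have "cmod (-1 - c) < 1"
    by (rule eigen [of S]) (simp_all add: generators_closed star_S_S P smult_minus_one)
  ultimately show False
    using norm_triangle_ineq4 [of "1 - c" "-1 - c"] by simp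
qed

end

section \<open>The Hilbert space of square-summable sequences\<close>

definition l2 :: "(nat \<Rightarrow> complex) set" where
  "l2 = {x. (\<lambda>i. (cmod (x i))\<^sup>2) summable_on UNIV}"

definition l2_norm :: "(nat \<Rightarrow> complex) \<Rightarrow> real" where
  "l2_norm x = sqrt (\<Sum>\<^sub>\<infinity>i. (cmod (x i))\<^sup>2)"

definition cscale :: "complex \<Rightarrow> (nat \<Rightarrow> complex) \<Rightarrow> nat \<Rightarrow> complex" where
  "cscale c x = (\<lambda>i. c * x i)"

definition inner_l2 :: "(nat \<Rightarrow> complex) \<Rightarrow> (nat \<Rightarrow> complex) \<Rightarrow> complex" where
  "inner_l2 x y = (\<Sum>\<^sub>\<infinity>i. x i * cnj (y i))"

lemma l2_norm_nonneg: "0 \<le> l2_norm x"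
  by (simp add: l2_norm_def infsum_nonneg)

lemma L2_set_le_l2_norm:
  assumes "x \<in> l2" "finite F"
  shows "L2_set (\<lambda>i. cmod (x i)) F \<le> l2_norm x"
  unfolding L2_set_def l2_norm_def
  by (rule real_sqrt_le_mono, rule finite_sum_le_infsum) (use assms in \<open>auto simp: l2_def\<close>)

text \<open>
  Membership and norm are controlled by finite partial sums. The estimates for
  sums, for reindexed sequences and for pointwise limits are made there.
\<close>

lemma l2_boundedI:
  assumes "\<And>F. finite F \<Longrightarrow> L2_set (\<lambda>i. cmod (x i)) F \<le> c"
  shows "x \<in> l2" "l2_norm x \<le> c"
proof -
  have c: "0 \<le> c" using assms [of "{}"] by simp
  have bound: "(\<Sum>i\<in>F. (cmod (x i))\<^sup>2) \<le> c\<^sup>2" if "finite F" for F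
    using assms [OF that] by (simp add: L2_set_def sqrt_le_D)
  show x: "x \<in> l2"
    unfolding l2_def mem_Collect_eq
    by (rule nonneg_bdd_above_summable_on) (auto intro!: bdd_aboveI [of _ "c\<^sup>2"] bound)
  have "(\<Sum>\<^sub>\<infinity>i. (cmod (x i))\<^sup>2) \<le> c\<^sup>2"
    by (rule infsum_le_finite_sums) (use x in \<open>auto simp: l2_def bound\<close>)
  then show "l2_norm x \<le> c"
    unfolding l2_norm_def using c by (simp add: real_le_lsqrt)
qed

lemma l2_zero [simp]: "0 \<in> l2" "l2_norm 0 = 0"
  by (simp_all add: l2_def l2_norm_def)

lemma l2_add:
  assumes "x \<in> l2" "y \<in> l2"
  shows "x + y \<in> l2" "l2_norm (x + y) \<le> l2_norm x + l2_norm y"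
proof -
  have "L2_set (\<lambda>i. cmod ((x + y) i)) F \<le> l2_norm x + l2_norm y" if "finite F" for F
  proof -
    have "L2_set (\<lambda>i. cmod ((x + y) i)) F \<le> L2_set (\<lambda>i. cmod (x i) + cmod (y i)) F"
      by (rule L2_set_mono) (simp_all add: norm_triangle_ineq)
    also have "\<dots> \<le> L2_set (\<lambda>i. cmod (x i)) F + L2_set (\<lambda>i. cmod (y i)) F"
      by (rule L2_set_triangle_ineq)
    also have "\<dots> \<le> l2_norm x + l2_norm y"
      by (intro add_mono L2_set_le_l2_norm assms that)
    finally show ?thesis .
  qed
  then show "x + y \<in> l2" "l2_norm (x + y) \<le> l2_norm x + l2_norm y"
    by (blast intro: l2_boundedI)+
qed

lemma l2_scale:
  assumes "x \<in> l2"
  shows "cscale c x \<in> l2"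
  using assms unfolding l2_def
  by (simp add: cscale_def norm_mult power_mult_distrib summable_on_cmult_right)

lemma l2_norm_scale: "l2_norm (cscale c x) = cmod c * l2_norm x"
  by (simp add: l2_norm_def cscale_def norm_mult power_mult_distrib infsum_cmult_right' real_sqrt_mult)

lemma uminus_eq_scale: "- x = cscale (-1) x"
  by (simp add: cscale_def fun_eq_iff)

lemma l2_diff:
  assumes "x \<in> l2" "y \<in> l2"
  shows "x - y \<in> l2" "l2_norm (x - y) \<le> l2_norm x + l2_norm y"
  using l2_add [OF assms(1) l2_scale [OF assms(2), of "-1"]] l2_norm_scale [of "-1" y]
  by (simp_all flip: uminus_eq_scale)

lemma cmod_le_l2_norm: "x \<in> l2 \<Longrightarrow> cmod (x i) \<le> l2_norm x"
  using L2_set_le_l2_norm [of x "{i}"] by (simp add: L2_set_def)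

lemma l2_norm_eq_zero: "x \<in> l2 \<Longrightarrow> l2_norm x = 0 \<longleftrightarrow> x = 0"
  using cmod_le_l2_norm [of x] by (fastforce simp: fun_eq_iff l2_norm_def)

lemma inner_l2_summable:
  assumes "x \<in> l2" "y \<in> l2"
  shows "(\<lambda>i. x i * cnj (y i)) abs_summable_on UNIV"
    and "cmod (inner_l2 x y) \<le> l2_norm x * l2_norm y"
proof -
  have bound: "(\<Sum>i\<in>F. norm (x i * cnj (y i))) \<le> l2_norm x * l2_norm y" if "finite F" for F
  proof -
    have "(\<Sum>i\<in>F. norm (x i * cnj (y i))) = (\<Sum>i\<in>F. \<bar>cmod (x i)\<bar> * \<bar>cmod (y i)\<bar>)"
      by (simp add: norm_mult)
    also have "\<dots> \<le> L2_set (\<lambda>i. cmod (x i)) F * L2_set (\<lambda>i. cmod (y i)) F"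
      by (rule L2_set_mult_ineq)
    also have "\<dots> \<le> l2_norm x * l2_norm y"
      by (intro mult_mono L2_set_le_l2_norm assms that) (simp_all add: l2_norm_nonneg)
    finally show ?thesis .
  qed
  show abs: "(\<lambda>i. x i * cnj (y i)) abs_summable_on UNIV"
    unfolding abs_summable_iff_bdd_above
    by (auto intro!: bdd_aboveI [of _ "l2_norm x * l2_norm y"] bound)
  have "cmod (inner_l2 x y) \<le> (\<Sum>\<^sub>\<infinity>i. norm (x i * cnj (y i)))"
    unfolding inner_l2_def by (rule norm_infsum_bound [OF abs])
  also have "\<dots> \<le> l2_norm x * l2_norm y"
    by (rule infsum_le_finite_sums [OF abs]) (simp add: bound)
  finally show "cmod (inner_l2 x y) \<le> l2_norm x * l2_norm y" .
qed

lemma inner_l2_add_left: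
  assumes "x \<in> l2" "y \<in> l2" "z \<in> l2"
  shows "inner_l2 (x + y) z = inner_l2 x z + inner_l2 y z"
proof -
  note summable = abs_summable_summable [OF inner_l2_summable(1)]
  show ?thesis
    using infsum_add [OF summable [OF assms(1,3)] summable [OF assms(2,3)]]
    by (simp add: inner_l2_def distrib_right)
qed

lemma inner_l2_scale_left: "inner_l2 (cscale c x) y = c * inner_l2 x y"
  by (simp add: inner_l2_def cscale_def infsum_cmult_right' mult.assoc)

lemma inner_l2_uminus_left: "inner_l2 (- x) y = - inner_l2 x y"
  by (simp add: uminus_eq_scale inner_l2_scale_left)

lemma inner_l2_cnj: "cnj (inner_l2 x y) = inner_l2 y x"
  unfolding inner_l2_def infsum_cnj [symmetric] by (simp add: mult.commute)

lemma inner_l2_add_right: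
  assumes "x \<in> l2" "y \<in> l2" "z \<in> l2"
  shows "inner_l2 z (x + y) = inner_l2 z x + inner_l2 z y"
  using arg_cong [OF inner_l2_add_left [OF assms], of cnj] by (simp add: inner_l2_cnj)

lemma inner_l2_scale_right: "inner_l2 x (cscale c y) = cnj c * inner_l2 x y"
  using arg_cong [OF inner_l2_scale_left [of c y x], of cnj] by (simp add: inner_l2_cnj)

lemma inner_l2_diff_left:
  assumes "x \<in> l2" "y \<in> l2" "z \<in> l2"
  shows "inner_l2 (x - y) z = inner_l2 x z - inner_l2 y z"
  using inner_l2_add_left [OF assms(1) l2_scale [OF assms(2), of "-1"] assms(3)]
  by (simp add: uminus_eq_scale [symmetric] inner_l2_uminus_left)

lemma inner_l2_diff_right:
  assumes "x \<in> l2" "y \<in> l2" "z \<in> l2"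
  shows "inner_l2 z (x - y) = inner_l2 z x - inner_l2 z y"
  using arg_cong [OF inner_l2_diff_left [OF assms], of cnj] by (simp add: inner_l2_cnj)

lemma inner_l2_self:
  assumes "x \<in> l2"
  shows "inner_l2 x x = complex_of_real ((l2_norm x)\<^sup>2)"
proof -
  have "((\<lambda>i. (cmod (x i))\<^sup>2) has_sum (\<Sum>\<^sub>\<infinity>i. (cmod (x i))\<^sup>2)) UNIV"
    using assms by (simp add: l2_def)
  then have "((\<lambda>i. complex_of_real ((cmod (x i))\<^sup>2)) has_sum
      complex_of_real (\<Sum>\<^sub>\<infinity>i. (cmod (x i))\<^sup>2)) UNIV"
    by (rule has_sum_of_real)
  then show ?thesis
    unfolding inner_l2_def complex_norm_square [symmetric]
    by (simp add: infsumI l2_norm_def infsum_nonneg)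
qed

lemma l2_eqI:
  assumes xy: "x \<in> l2" "y \<in> l2" and eq: "\<And>z. z \<in> l2 \<Longrightarrow> inner_l2 x z = inner_l2 y z"
  shows "x = y"
proof -
  have z: "x - y \<in> l2" using l2_diff [OF xy] by simp
  have "inner_l2 (x - y) (x - y) = 0"
    using eq [OF z] inner_l2_diff_left [OF xy z] by simp
  then have "l2_norm (x - y) = 0" using inner_l2_self [OF z] by simp
  then show ?thesis using l2_norm_eq_zero [OF z] by simp
qed

section \<open>Bounded operators on square-summable sequences\<close>

text \<open>
  Operators are total functions on all sequences; requiring the value \<open>0\<close> outside the Hilbert space
  makes an operator determined by what it does inside.
\<close>

definition bounded_map :: "sequence_operator \<Rightarrow> bool" where
  "bounded_map T \<longleftrightarrow> (\<forall>x. T x \<in> l2) \<and> (\<forall>x. x \<notin> l2 \<longrightarrow> T x = 0) \<and>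
     (\<exists>k\<ge>0. \<forall>x\<in>l2. l2_norm (T x) \<le> k * l2_norm x)"

text \<open>
  Linearity is a consequence of having an adjoint (\<open>adjoint_pair_linear\<close>). The relation is symmetric
  and determines the second component, so the algebra operations can be treated together with the
  involution.
\<close>

definition adjoint_pair :: "sequence_operator \<Rightarrow> sequence_operator \<Rightarrow> bool" where
  "adjoint_pair T T' \<longleftrightarrow> bounded_map T \<and> bounded_map T' \<and>
     (\<forall>x\<in>l2. \<forall>y\<in>l2. inner_l2 (T x) y = inner_l2 x (T' y))"

lemma bounded_mapI:
  assumes "\<And>x. T x \<in> l2" "\<And>x. x \<notin> l2 \<Longrightarrow> T x = 0" "0 \<le> k"
    and "\<And>x. x \<in> l2 \<Longrightarrow> l2_norm (T x) \<le> k * l2_norm x"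
  shows "bounded_map T"
  unfolding bounded_map_def using assms by blast

lemma adjoint_pairD:
  assumes "adjoint_pair T T'"
  shows "bounded_map T" "bounded_map T'" "T x \<in> l2" "x \<notin> l2 \<Longrightarrow> T x = 0"
    and "x \<in> l2 \<Longrightarrow> y \<in> l2 \<Longrightarrow> inner_l2 (T x) y = inner_l2 x (T' y)"
  using assms unfolding adjoint_pair_def bounded_map_def by blast+

lemma adjoint_pair_sym: "adjoint_pair T T' \<Longrightarrow> adjoint_pair T' T"
  unfolding adjoint_pair_def by (metis inner_l2_cnj)

lemma adjoint_pair_unique:
  assumes "adjoint_pair T T'" "adjoint_pair T T''"
  shows "T' = T''"
proof
  fix x
  show "T' x = T'' x"
  proof (cases "x \<in> l2")
    case True
    note sym = assms [THEN adjoint_pair_sym]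
    show ?thesis
      by (rule l2_eqI) (simp_all add: sym [THEN adjoint_pairD(3)] sym [THEN adjoint_pairD(5)] True)
  next
    case False
    then show ?thesis using assms [THEN adjoint_pair_sym] by (simp add: adjoint_pairD(4))
  qed
qed

lemma adjoint_pair_linear:
  assumes "adjoint_pair T T'" "x \<in> l2"
  shows "y \<in> l2 \<Longrightarrow> T (x + y) = T x + T y" and "T (cscale c x) = cscale c (T x)"
proof -
  note T = adjoint_pairD [OF assms(1)] adjoint_pairD(3) [OF adjoint_pair_sym [OF assms(1)]]
  show "T (x + y) = T x + T y" if "y \<in> l2"
    by (rule l2_eqI) (simp_all add: T l2_add assms(2) that inner_l2_add_left)
  show "T (cscale c x) = cscale c (T x)"
    by (rule l2_eqI) (simp_all add: T l2_scale assms(2) inner_l2_scale_left)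
qed

lemma adjoint_pair_zero_arg: "adjoint_pair T T' \<Longrightarrow> T 0 = 0"
  using adjoint_pair_linear(1) [of T T' 0 0] by simp

definition op_norm :: "sequence_operator \<Rightarrow> real" where
  "op_norm T = Inf {k. 0 \<le> k \<and> (\<forall>x\<in>l2. l2_norm (T x) \<le> k * l2_norm x)}"

lemma op_norm_le:
  assumes "0 \<le> k" "\<And>x. x \<in> l2 \<Longrightarrow> l2_norm (T x) \<le> k * l2_norm x"
  shows "op_norm T \<le> k"
  unfolding op_norm_def by (rule cInf_lower) (use assms in \<open>auto intro: bdd_belowI\<close>)

lemma op_norm_nonneg:
  assumes "bounded_map T"
  shows "0 \<le> op_norm T"
  unfolding op_norm_def
  by (rule cInf_greatest) (use assms in \<open>auto simp: bounded_map_def\<close>)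

lemma l2_norm_le_op_norm:
  assumes "bounded_map T" "x \<in> l2"
  shows "l2_norm (T x) \<le> op_norm T * l2_norm x"
proof (cases "l2_norm x = 0")
  case True
  then show ?thesis using assms by (auto simp: bounded_map_def)
next
  case False
  then have pos: "0 < l2_norm x" using l2_norm_nonneg [of x] by simp
  have "l2_norm (T x) / l2_norm x \<le> op_norm T"
    unfolding op_norm_def
    by (rule cInf_greatest)
      (use assms pos in \<open>auto simp: bounded_map_def pos_divide_le_eq\<close>)
  then show ?thesis using pos by (simp add: pos_divide_le_eq)
qed

lemma adjoint_pair_zero: "adjoint_pair 0 0"
  by (auto simp: adjoint_pair_def inner_l2_def intro!: bounded_mapI [of _ 0])

lemma adjoint_pair_id: "adjoint_pair (\<lambda>x. if x \<in> l2 then x else 0) (\<lambda>x. if x \<in> l2 then x else 0)"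
  unfolding adjoint_pair_def by (auto intro!: bounded_mapI [of _ 1])

lemma adjoint_pair_add:
  assumes "adjoint_pair S S'" "adjoint_pair T T'"
  shows "adjoint_pair (S + T) (S' + T')"
proof -
  have bm: "bounded_map (S + T)" if "bounded_map S" "bounded_map T" for S T
  proof (rule bounded_mapI [of _ "op_norm S + op_norm T"])
    fix x assume x: "x \<in> l2"
    have "l2_norm ((S + T) x) \<le> l2_norm (S x) + l2_norm (T x)"
      using that by (simp add: l2_add bounded_map_def)
    also have "\<dots> \<le> op_norm S * l2_norm x + op_norm T * l2_norm x"
      by (intro add_mono l2_norm_le_op_norm that x)
    finally show "l2_norm ((S + T) x) \<le> (op_norm S + op_norm T) * l2_norm x"
      by (simp add: distrib_right)
  qed (use that in \<open>auto simp: bounded_map_def l2_add intro!: add_nonneg_nonneg op_norm_nonneg\<close>)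
  note sym = assms [THEN adjoint_pair_sym]
  show ?thesis
    unfolding adjoint_pair_def
    using assms sym by (auto simp: bm adjoint_pairD inner_l2_add_left inner_l2_add_right)
qed

lemma adjoint_pair_scale:
  assumes "adjoint_pair T T'"
  shows "adjoint_pair (\<lambda>x. cscale c (T x)) (\<lambda>x. cscale (cnj c) (T' x))"
proof -
  have bm: "bounded_map (\<lambda>x. cscale c (T x))" if "bounded_map T" for c T
  proof (rule bounded_mapI [of _ "cmod c * op_norm T"])
    fix x assume x: "x \<in> l2"
    show "l2_norm (cscale c (T x)) \<le> cmod c * op_norm T * l2_norm x"
      by (simp add: l2_norm_scale mult.assoc mult_left_mono l2_norm_le_op_norm that x)
  next
    show "cscale c (T x) \<in> l2" for x using that by (simp add: bounded_map_def l2_scale)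
    show "cscale c (T x) = 0" if "x \<notin> l2" for x
      using that \<open>bounded_map T\<close> by (simp add: bounded_map_def cscale_def fun_eq_iff)
  qed (simp add: op_norm_nonneg that)
  show ?thesis
    unfolding adjoint_pair_def using assms
    by (auto simp: bm adjoint_pairD inner_l2_scale_left inner_l2_scale_right)
qed

lemma l2_norm_comp_le:
  assumes "bounded_map S" "bounded_map T" "x \<in> l2"
  shows "l2_norm ((S \<circ> T) x) \<le> op_norm S * op_norm T * l2_norm x"
proof -
  have "l2_norm (S (T x)) \<le> op_norm S * l2_norm (T x)"
    using assms(1,2) by (intro l2_norm_le_op_norm) (auto simp: bounded_map_def)
  also have "\<dots> \<le> op_norm S * (op_norm T * l2_norm x)"
    by (intro mult_left_mono l2_norm_le_op_norm op_norm_nonneg assms)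
  finally show ?thesis by (simp add: mult.assoc)
qed

lemma adjoint_pair_comp:
  assumes "adjoint_pair S S'" "adjoint_pair T T'"
  shows "adjoint_pair (S \<circ> T) (T' \<circ> S')"
proof -
  have bm: "bounded_map (S \<circ> T)" if "adjoint_pair S S'" "adjoint_pair T T'" for S S' T T'
  proof (rule bounded_mapI [of _ "op_norm S * op_norm T"])
    show "0 \<le> op_norm S * op_norm T" by (simp add: op_norm_nonneg that [THEN adjoint_pairD(1)])
    show "(S \<circ> T) x \<in> l2" for x by (simp add: adjoint_pairD(3) [OF that(1)])
    show "(S \<circ> T) x = 0" if "x \<notin> l2" for x
      using adjoint_pairD(4) [OF \<open>adjoint_pair T T'\<close> that] adjoint_pair_zero_arg [OF \<open>adjoint_pair S S'\<close>]
      by simp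
  qed (rule l2_norm_comp_le [OF that [THEN adjoint_pairD(1)]])
  note sym = assms [THEN adjoint_pair_sym]
  have "inner_l2 (S (T x)) y = inner_l2 x (T' (S' y))" if "x \<in> l2" "y \<in> l2" for x y
    using assms sym that by (simp add: adjoint_pairD(3,5))
  then show ?thesis
    unfolding adjoint_pair_def using bm [OF assms] bm [OF sym(2,1)] by simp
qed

lemma op_norm_comp_le:
  assumes "bounded_map S" "bounded_map T"
  shows "op_norm (S \<circ> T) \<le> op_norm S * op_norm T"
  by (rule op_norm_le) (simp_all add: op_norm_nonneg assms l2_norm_comp_le del: comp_apply)

text \<open>
  \<open>norm (T' y)^2 = <T (T' y), y> \<le> norm T * norm (T' y) * norm y\<close>; cancel \<open>norm (T' y)\<close>.
\<close>

lemma op_norm_adjoint_le: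
  assumes "adjoint_pair T T'"
  shows "op_norm T' \<le> op_norm T"
proof (rule op_norm_le)
  note T = adjoint_pairD [OF assms] and T' = adjoint_pairD [OF adjoint_pair_sym [OF assms]]
  show "0 \<le> op_norm T" by (simp add: op_norm_nonneg T)
  fix y assume y: "y \<in> l2"
  show "l2_norm (T' y) \<le> op_norm T * l2_norm y"
  proof (cases "l2_norm (T' y) = 0")
    case True
    then show ?thesis by (simp add: op_norm_nonneg T l2_norm_nonneg)
  next
    case False
    have "complex_of_real ((l2_norm (T' y))\<^sup>2) = inner_l2 (T (T' y)) y"
      by (simp add: T T' y inner_l2_self)
    then have "(l2_norm (T' y))\<^sup>2 = cmod (inner_l2 (T (T' y)) y)"
      by (metis norm_of_real abs_of_nonneg zero_le_power2)
    also have "\<dots> \<le> l2_norm (T (T' y)) * l2_norm y"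
      by (simp add: inner_l2_summable T y)
    also have "\<dots> \<le> op_norm T * l2_norm (T' y) * l2_norm y"
      by (intro mult_right_mono l2_norm_le_op_norm l2_norm_nonneg T T')
    finally have "l2_norm (T' y) * l2_norm (T' y) \<le> (op_norm T * l2_norm y) * l2_norm (T' y)"
      by (simp add: power2_eq_square mult_ac)
    then show ?thesis using False l2_norm_nonneg [of "T' y"] by simp
  qed
qed

lemma op_norm_cstar:
  assumes "adjoint_pair T T'"
  shows "op_norm (T' \<circ> T) = (op_norm T)\<^sup>2"
proof (rule antisym)
  note sym = adjoint_pair_sym [OF assms]
  note T = adjoint_pairD [OF assms] and T' = adjoint_pairD [OF sym]
  note TT = adjoint_pairD(1) [OF adjoint_pair_comp [OF sym assms]]
  have "op_norm (T' \<circ> T) \<le> op_norm T' * op_norm T"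
    by (rule op_norm_comp_le [OF T'(1) T(1)])
  also have "\<dots> \<le> op_norm T * op_norm T"
    by (intro mult_right_mono op_norm_adjoint_le [OF assms] op_norm_nonneg T)
  finally show "op_norm (T' \<circ> T) \<le> (op_norm T)\<^sup>2" by (simp add: power2_eq_square)
  have "op_norm T \<le> sqrt (op_norm (T' \<circ> T))"
  proof (rule op_norm_le)
    show "0 \<le> sqrt (op_norm (T' \<circ> T))" by (simp add: op_norm_nonneg TT)
    fix x assume x: "x \<in> l2"
    have "complex_of_real ((l2_norm (T x))\<^sup>2) = inner_l2 x ((T' \<circ> T) x)"
      using T(5) [OF x T(3) [of x]] inner_l2_self [OF T(3) [of x]] by simp
    then have "(l2_norm (T x))\<^sup>2 = cmod (inner_l2 x ((T' \<circ> T) x))"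
      by (metis norm_of_real abs_of_nonneg zero_le_power2)
    also have "\<dots> \<le> l2_norm x * l2_norm ((T' \<circ> T) x)"
      by (rule inner_l2_summable) (simp_all add: T' x)
    also have "\<dots> \<le> l2_norm x * (op_norm (T' \<circ> T) * l2_norm x)"
      by (intro mult_left_mono l2_norm_le_op_norm l2_norm_nonneg TT x)
    finally have "(l2_norm (T x))\<^sup>2 \<le> op_norm (T' \<circ> T) * (l2_norm x)\<^sup>2"
      by (simp add: power2_eq_square mult_ac)
    then show "l2_norm (T x) \<le> sqrt (op_norm (T' \<circ> T)) * l2_norm x"
      using real_sqrt_le_mono by (fastforce simp: real_sqrt_mult l2_norm_nonneg)
  qed
  then have "(op_norm T)\<^sup>2 \<le> (sqrt (op_norm (T' \<circ> T)))\<^sup>2"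
    by (intro power_mono) (simp_all add: op_norm_nonneg T)
  then show "(op_norm T)\<^sup>2 \<le> op_norm (T' \<circ> T)" by (simp add: op_norm_nonneg TT)
qed

text \<open>
  The limit exists entrywise. The Cauchy estimate holds on every finite set of indices, where it
  survives the limit, and so transfers to the norm.
\<close>

lemma bounded_map_limit:
  fixes X :: "nat \<Rightarrow> sequence_operator"
  assumes bm: "\<And>n. bounded_map (X n)"
    and cauchy: "\<And>\<epsilon>. 0 < \<epsilon> \<Longrightarrow>
      \<exists>N. \<forall>m\<ge>N. \<forall>n\<ge>N. \<forall>x\<in>l2. l2_norm (X m x - X n x) \<le> \<epsilon> * l2_norm x"
  obtains T where "bounded_map T"
    and "\<And>\<epsilon>. 0 < \<epsilon> \<Longrightarrow> \<exists>N. \<forall>n\<ge>N. \<forall>x\<in>l2. l2_norm (X n x - T x) \<le> \<epsilon> * l2_norm x"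
proof -
  have X: "X n x \<in> l2" "x \<notin> l2 \<Longrightarrow> X n x = 0" for n x
    using bm unfolding bounded_map_def by blast+
  define T where "T x i = lim (\<lambda>n. X n x i)" for x i
  have conv: "(\<lambda>n. X n x i) \<longlonglongrightarrow> T x i" for x i
  proof (cases "x \<in> l2")
    case True
    have "Cauchy (\<lambda>n. X n x i)"
    proof (rule CauchyI)
      fix e :: real assume e: "0 < e"
      \<comment> \<open>Adding 1 keeps the denominator positive when \<open>x\<close> is zero.\<close>
      have pos: "0 < e / (l2_norm x + 1)"
        using e by (simp add: add_nonneg_pos l2_norm_nonneg)
      obtain N where N: "\<And>m n. m \<ge> N \<Longrightarrow> n \<ge> N \<Longrightarrow>
          l2_norm (X m x - X n x) \<le> e / (l2_norm x + 1) * l2_norm x"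
        using cauchy [OF pos] True by blast
      have "e / (l2_norm x + 1) * l2_norm x < e"
        using e l2_norm_nonneg [of x] by (simp add: field_simps add_nonneg_pos)
      then have "norm (X m x i - X n x i) < e" if "m \<ge> N" "n \<ge> N" for m n
        using N [OF that] cmod_le_l2_norm [OF l2_diff(1) [OF X(1) X(1)], of m x n x i] by simp
      then show "\<exists>M. \<forall>m\<ge>M. \<forall>n\<ge>M. norm (X m x i - X n x i) < e" by blast
    qed
    then show ?thesis
      unfolding T_def by (intro convergent_LIMSEQ_iff [THEN iffD1] Cauchy_convergent)
  qed (simp add: T_def X)
  have close: "X n x - T x \<in> l2 \<and> l2_norm (X n x - T x) \<le> c"
    if "\<And>m. m \<ge> N \<Longrightarrow> l2_norm (X n x - X m x) \<le> c" for x n N c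
  proof -
    have "L2_set (\<lambda>i. cmod ((X n x - T x) i)) F \<le> c" if F: "finite F" for F
    proof (rule LIMSEQ_le_const2)
      show "(\<lambda>m. L2_set (\<lambda>i. cmod ((X n x - X m x) i)) F) \<longlonglongrightarrow> L2_set (\<lambda>i. cmod ((X n x - T x) i)) F"
        unfolding L2_set_def fun_diff_def by (intro tendsto_intros conv)
      have "L2_set (\<lambda>i. cmod ((X n x - X m x) i)) F \<le> c" if "m \<ge> N" for m
        using L2_set_le_l2_norm [OF l2_diff(1) [OF X(1) X(1)] F, of n x m x]
          \<open>\<And>m. m \<ge> N \<Longrightarrow> l2_norm (X n x - X m x) \<le> c\<close> [OF that] by simp
      then show "\<exists>M. \<forall>m\<ge>M. L2_set (\<lambda>i. cmod ((X n x - X m x) i)) F \<le> c" by blast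
    qed
    from l2_boundedI [of "X n x - T x", OF this] show ?thesis by simp
  qed
  have unif: "\<exists>N. \<forall>n\<ge>N. \<forall>x\<in>l2. X n x - T x \<in> l2 \<and> l2_norm (X n x - T x) \<le> \<epsilon> * l2_norm x"
    if "0 < \<epsilon>" for \<epsilon> :: real
    using cauchy [OF that] close by meson
  have "bounded_map T"
  proof -
    obtain n where n: "\<And>x. x \<in> l2 \<Longrightarrow> X n x - T x \<in> l2"
      "\<And>x. x \<in> l2 \<Longrightarrow> l2_norm (X n x - T x) \<le> 1 * l2_norm x"
      using unif [of 1] by auto
    have zero: "T x = 0" if "x \<notin> l2" for x
      using that by (simp add: T_def X fun_eq_iff)
    have T: "T x = X n x - (X n x - T x)" for x by simp
    show ?thesis
    proof (rule bounded_mapI [of _ "op_norm (X n) + 1"])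
      show "T x \<in> l2" for x
      proof (cases "x \<in> l2")
        case True
        then show ?thesis by (subst T) (intro l2_diff X n)
      qed (simp add: zero)
      fix x assume x: "x \<in> l2"
      have "l2_norm (T x) \<le> l2_norm (X n x) + l2_norm (X n x - T x)"
        by (subst T) (intro l2_diff X n x)
      also have "\<dots> \<le> op_norm (X n) * l2_norm x + 1 * l2_norm x"
        by (intro add_mono l2_norm_le_op_norm bm n x)
      finally show "l2_norm (T x) \<le> (op_norm (X n) + 1) * l2_norm x"
        by (simp add: distrib_right)
    qed (simp_all add: zero op_norm_nonneg bm add_nonneg_nonneg)
  qed
  then show ?thesis using unif that by blast
qed

definition l2_operators :: "sequence_operator normed_star_alg" where
  "l2_operators = \<lparr>
     carrier = {T. \<exists>T'. adjoint_pair T T'},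
     monoid.mult = (\<circ>),
     one = (\<lambda>x. if x \<in> l2 then x else 0),
     ring.zero = 0,
     ring.add = (+),
     smult = (\<lambda>c T x. cscale c (T x)),
     star = (\<lambda>T. THE T'. adjoint_pair T T'),
     nrm = op_norm\<rparr>"

lemma l2_operators_simps:
  "T \<in> carrier l2_operators \<longleftrightarrow> (\<exists>T'. adjoint_pair T T')"
  "S \<otimes>\<^bsub>l2_operators\<^esub> T = S \<circ> T"
  "\<one>\<^bsub>l2_operators\<^esub> = (\<lambda>x. if x \<in> l2 then x else 0)"
  "\<zero>\<^bsub>l2_operators\<^esub> = 0"
  "S \<oplus>\<^bsub>l2_operators\<^esub> T = S + T"
  "c \<odot>\<^bsub>l2_operators\<^esub> T = (\<lambda>x. cscale c (T x))"
  "nrm l2_operators = op_norm"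
  by (simp_all add: l2_operators_def)

lemma star_l2_operators:
  "adjoint_pair T T' \<Longrightarrow> star l2_operators T = T'"
  by (auto simp: l2_operators_def intro: the_equality adjoint_pair_unique)

lemma adjoint_pair_star:
  "T \<in> carrier l2_operators \<Longrightarrow> adjoint_pair T (star l2_operators T)"
  by (auto simp: l2_operators_simps star_l2_operators)

lemma adjoint_pair_uminus: "adjoint_pair T T' \<Longrightarrow> adjoint_pair (- T) (- T')"
  using adjoint_pair_scale [of T T' "-1"] by (simp add: fun_Compl_def flip: uminus_eq_scale)

lemma ring_l2_operators: "ring l2_operators"
proof (rule ringI)
  show "abelian_group l2_operators"
  proof (rule abelian_groupI)
    show "\<exists>T'\<in>carrier l2_operators. T' \<oplus>\<^bsub>l2_operators\<^esub> T = \<zero>\<^bsub>l2_operators\<^esub>"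
      if "T \<in> carrier l2_operators" for T
    proof (rule bexI)
      show "- T \<oplus>\<^bsub>l2_operators\<^esub> T = \<zero>\<^bsub>l2_operators\<^esub>" by (simp add: l2_operators_simps)
      show "- T \<in> carrier l2_operators"
        using that adjoint_pair_uminus unfolding l2_operators_simps by blast
    qed
  qed (auto simp: l2_operators_simps ac_simps intro: adjoint_pair_add adjoint_pair_zero)
  show "monoid l2_operators"
  proof (rule monoidI)
    fix T assume "T \<in> carrier l2_operators"
    then obtain T' where T: "adjoint_pair T T'" by (auto simp: l2_operators_simps)
    show "\<one>\<^bsub>l2_operators\<^esub> \<otimes>\<^bsub>l2_operators\<^esub> T = T" "T \<otimes>\<^bsub>l2_operators\<^esub> \<one>\<^bsub>l2_operators\<^esub> = T"
      using adjoint_pairD [OF T] adjoint_pair_zero_arg [OF T]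
      by (auto simp: l2_operators_simps fun_eq_iff)
  qed (auto simp: l2_operators_simps comp_assoc intro: adjoint_pair_comp adjoint_pair_id)
  show "(R \<oplus>\<^bsub>l2_operators\<^esub> S) \<otimes>\<^bsub>l2_operators\<^esub> T =
      R \<otimes>\<^bsub>l2_operators\<^esub> T \<oplus>\<^bsub>l2_operators\<^esub> S \<otimes>\<^bsub>l2_operators\<^esub> T" for R S T
    by (simp add: l2_operators_simps fun_eq_iff)
  show "T \<otimes>\<^bsub>l2_operators\<^esub> (R \<oplus>\<^bsub>l2_operators\<^esub> S) =
      T \<otimes>\<^bsub>l2_operators\<^esub> R \<oplus>\<^bsub>l2_operators\<^esub> T \<otimes>\<^bsub>l2_operators\<^esub> S"
    if "R \<in> carrier l2_operators" "S \<in> carrier l2_operators" "T \<in> carrier l2_operators" for R S T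
    using that by (auto simp: l2_operators_simps fun_eq_iff adjoint_pair_linear(1) adjoint_pairD(3))
qed

lemma minus_l2_operators:
  assumes "S \<in> carrier l2_operators" "T \<in> carrier l2_operators"
  shows "S \<ominus>\<^bsub>l2_operators\<^esub> T = S - T"
proof -
  interpret ring l2_operators by (rule ring_l2_operators)
  have "\<ominus>\<^bsub>l2_operators\<^esub> T = - T"
    by (rule minus_equality)
      (use assms adjoint_pair_uminus in \<open>auto simp: l2_operators_simps\<close>)
  then show ?thesis by (simp add: minus_eq l2_operators_simps)
qed

lemma op_norm_scale_le:
  assumes "bounded_map T"
  shows "op_norm (\<lambda>x. cscale c (T x)) \<le> cmod c * op_norm T"
  by (rule op_norm_le)
    (simp_all add: op_norm_nonneg assms l2_norm_scale mult.assoc mult_left_mono l2_norm_le_op_norm)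

text \<open>
  Passing to the adjoint does not increase the norm, so the adjoints form a Cauchy sequence as well;
  the two limits are adjoint to each other by continuity of the inner product.
\<close>

lemma complete_l2_operators:
  assumes X: "\<And>n. X n \<in> carrier l2_operators"
    and cauchy: "\<forall>\<epsilon>>0. \<exists>N. \<forall>m\<ge>N. \<forall>n\<ge>N. op_norm (X m - X n) < \<epsilon>"
  shows "\<exists>T\<in>carrier l2_operators. (\<lambda>n. op_norm (X n - T)) \<longlonglongrightarrow> 0"
proof -
  define X' where "X' n = star l2_operators (X n)" for n
  have pair: "adjoint_pair (X n) (X' n)" for n
    unfolding X'_def by (rule adjoint_pair_star [OF X])
  have diff: "adjoint_pair (X m - X n) (X' m - X' n)" for m n
    using adjoint_pair_add [OF pair adjoint_pair_uminus [OF pair], of m n] by simp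
  have small: "\<exists>N. \<forall>m\<ge>N. \<forall>n\<ge>N. \<forall>x\<in>l2. l2_norm (Y m x - Y n x) \<le> \<epsilon> * l2_norm x"
    if pos: "0 < \<epsilon>" and Y: "\<And>m n. bounded_map (Y m - Y n)"
      "\<And>m n. op_norm (Y m - Y n) \<le> op_norm (X m - X n)" for Y and \<epsilon> :: real
  proof -
    obtain N where N: "\<forall>m\<ge>N. \<forall>n\<ge>N. op_norm (X m - X n) < \<epsilon>"
      using cauchy pos by blast
    have "l2_norm (Y m x - Y n x) \<le> \<epsilon> * l2_norm x" if "m \<ge> N" "n \<ge> N" "x \<in> l2" for m n x
    proof -
      have "l2_norm (Y m x - Y n x) \<le> op_norm (Y m - Y n) * l2_norm x"
        using l2_norm_le_op_norm [OF Y(1) that(3), of m n] by simp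
      also have "\<dots> \<le> \<epsilon> * l2_norm x"
        using Y(2) [of m n] N [rule_format, OF that(1,2)] by (intro mult_right_mono) (simp_all add: l2_norm_nonneg)
      finally show ?thesis .
    qed
    then show ?thesis by blast
  qed
  obtain T where T: "bounded_map T"
    and limT: "\<And>\<epsilon>. 0 < \<epsilon> \<Longrightarrow> \<exists>N. \<forall>n\<ge>N. \<forall>x\<in>l2. l2_norm (X n x - T x) \<le> \<epsilon> * l2_norm x"
    using bounded_map_limit [of X] small [of _ X] adjoint_pairD(1) [OF pair] adjoint_pairD(1) [OF diff]
    by (metis order_refl)
  obtain T' where T': "bounded_map T'"
    and limT': "\<And>\<epsilon>. 0 < \<epsilon> \<Longrightarrow> \<exists>N. \<forall>n\<ge>N. \<forall>x\<in>l2. l2_norm (X' n x - T' x) \<le> \<epsilon> * l2_norm x"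
    using bounded_map_limit [of X'] small [of _ X'] adjoint_pairD(2) [OF pair]
      adjoint_pairD(2) [OF diff] op_norm_adjoint_le [OF diff] by metis
  have l2: "X n x \<in> l2" "X' n x \<in> l2" "T x \<in> l2" "T' x \<in> l2" for n x
    using adjoint_pairD(3) [OF pair] adjoint_pairD(3) [OF adjoint_pair_sym [OF pair]] T T'
    by (auto simp: bounded_map_def)
  have "inner_l2 (T x) y = inner_l2 x (T' y)" if xy: "x \<in> l2" "y \<in> l2" for x y
  proof -
    have le: "cmod (inner_l2 (T x) y - inner_l2 x (T' y)) \<le> e" if e: "0 < e" for e :: real
    proof -
      \<comment> \<open>Adding 1 keeps the denominator positive when \<open>x\<close> or \<open>y\<close> is zero.\<close>
      define d where "d = e / (2 * (l2_norm x * l2_norm y) + 1)"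
      have pos: "0 < 2 * (l2_norm x * l2_norm y) + 1"
        using l2_norm_nonneg [of x] l2_norm_nonneg [of y] by (simp add: add_nonneg_pos)
      then have d: "0 < d" unfolding d_def using e by simp
      obtain N N' where N: "\<And>n. n \<ge> N \<Longrightarrow> l2_norm (X n x - T x) \<le> d * l2_norm x"
        and N': "\<And>n. n \<ge> N' \<Longrightarrow> l2_norm (X' n y - T' y) \<le> d * l2_norm y"
        using limT [OF d] limT' [OF d] xy by blast
      define n where "n = max N N'"
      have "inner_l2 (T x) y - inner_l2 x (T' y)
          = inner_l2 x (X' n y - T' y) - inner_l2 (X n x - T x) y"
        using xy l2 by (simp add: inner_l2_diff_left inner_l2_diff_right adjoint_pairD(5) [OF pair])
      then have "cmod (inner_l2 (T x) y - inner_l2 x (T' y))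
          \<le> cmod (inner_l2 x (X' n y - T' y)) + cmod (inner_l2 (X n x - T x) y)"
        by (simp add: norm_triangle_ineq4)
      also have "\<dots> \<le> l2_norm x * l2_norm (X' n y - T' y) + l2_norm (X n x - T x) * l2_norm y"
        by (intro add_mono inner_l2_summable l2_diff l2 xy)
      also have "\<dots> \<le> l2_norm x * (d * l2_norm y) + d * l2_norm x * l2_norm y"
        by (intro add_mono mult_left_mono mult_right_mono N N' l2_norm_nonneg) (simp_all add: n_def)
      also have "\<dots> \<le> d * (2 * (l2_norm x * l2_norm y) + 1)"
        using d by (simp add: algebra_simps)
      also have "\<dots> = e" using pos by (simp add: d_def)
      finally show ?thesis .
    qed
    have "cmod (inner_l2 (T x) y - inner_l2 x (T' y)) \<le> 0"
      by (rule field_le_epsilon) (simp add: le)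
    then show ?thesis by simp
  qed
  then have "adjoint_pair T T'" unfolding adjoint_pair_def using T T' by blast
  moreover have "(\<lambda>n. op_norm (X n - T)) \<longlonglongrightarrow> 0"
  proof (rule LIMSEQ_I)
    fix e :: real assume e: "0 < e"
    obtain N where N: "\<And>n x. n \<ge> N \<Longrightarrow> x \<in> l2 \<Longrightarrow> l2_norm (X n x - T x) \<le> e / 2 * l2_norm x"
      using limT [of "e / 2"] e by auto
    show "\<exists>N. \<forall>n\<ge>N. norm (op_norm (X n - T) - 0) < e"
    proof (intro exI allI impI)
      fix n assume "N \<le> n"
      then have "op_norm (X n - T) \<le> e / 2"
        using N e by (intro op_norm_le) simp_all
      moreover have "0 \<le> op_norm (X n - T)"
        using adjoint_pair_add [OF pair adjoint_pair_uminus [OF \<open>adjoint_pair T T'\<close>], of n]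
        by (intro op_norm_nonneg) (auto dest: adjoint_pairD(1))
      ultimately show "norm (op_norm (X n - T) - 0) < e" using e by simp
    qed
  qed
  ultimately show ?thesis
    by (intro bexI [of _ T]) (auto simp: l2_operators_simps)
qed

theorem unital_cstar_algebra_l2_operators: "unital_cstar_algebra l2_operators"
proof -
  interpret ring l2_operators by (rule ring_l2_operators)
  note simps = l2_operators_simps(2-7)
  have pair: "adjoint_pair T (star l2_operators T)" if "T \<in> carrier l2_operators" for T
    by (rule adjoint_pair_star [OF that])
  have bm: "bounded_map T" if "T \<in> carrier l2_operators" for T
    using adjoint_pairD(1) [OF pair [OF that]] .
  have carrierI: "T \<in> carrier l2_operators" if "adjoint_pair T T'" for T T'
    using that by (auto simp: l2_operators_simps)
  show ?thesis
  proof unfold_locales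
    fix c d and S T :: sequence_operator
    assume S: "S \<in> carrier l2_operators"
    show "c \<odot>\<^bsub>l2_operators\<^esub> S \<in> carrier l2_operators"
      unfolding simps by (rule carrierI [OF adjoint_pair_scale [OF pair [OF S]]])
    show "(c + d) \<odot>\<^bsub>l2_operators\<^esub> S =
        c \<odot>\<^bsub>l2_operators\<^esub> S \<oplus>\<^bsub>l2_operators\<^esub> d \<odot>\<^bsub>l2_operators\<^esub> S"
      by (simp add: simps cscale_def fun_eq_iff distrib_right)
    show "(c * d) \<odot>\<^bsub>l2_operators\<^esub> S = c \<odot>\<^bsub>l2_operators\<^esub> (d \<odot>\<^bsub>l2_operators\<^esub> S)"
      by (simp add: simps cscale_def mult.assoc)
    show "1 \<odot>\<^bsub>l2_operators\<^esub> S = S"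
      by (simp add: simps cscale_def)
    show "star l2_operators S \<in> carrier l2_operators"
      by (rule carrierI [OF adjoint_pair_sym [OF pair [OF S]]])
    show "star l2_operators (star l2_operators S) = S"
      by (rule star_l2_operators [OF adjoint_pair_sym [OF pair [OF S]]])
    show "star l2_operators (c \<odot>\<^bsub>l2_operators\<^esub> S) = cnj c \<odot>\<^bsub>l2_operators\<^esub> star l2_operators S"
      unfolding simps by (rule star_l2_operators [OF adjoint_pair_scale [OF pair [OF S]]])
    show "0 \<le> nrm l2_operators S" by (simp add: simps op_norm_nonneg bm S)
    show "nrm l2_operators S = 0 \<longleftrightarrow> S = \<zero>\<^bsub>l2_operators\<^esub>"
    proof
      assume "nrm l2_operators S = 0"
      then have le: "l2_norm (S x) \<le> 0" if "x \<in> l2" for x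
        using l2_norm_le_op_norm [OF bm [OF S] that] by (simp add: simps)
      have "S x = 0" for x
      proof (cases "x \<in> l2")
        case True
        then have "l2_norm (S x) = 0" using le l2_norm_nonneg [of "S x"] by (simp add: antisym)
        then show ?thesis using l2_norm_eq_zero [OF adjoint_pairD(3) [OF pair [OF S]]] by simp
      qed (simp add: adjoint_pairD(4) [OF pair [OF S]])
      then show "S = \<zero>\<^bsub>l2_operators\<^esub>" by (simp add: simps fun_eq_iff)
    next
      assume "S = \<zero>\<^bsub>l2_operators\<^esub>"
      then have "op_norm S \<le> 0" by (intro op_norm_le) (simp_all add: simps)
      then show "nrm l2_operators S = 0"
        using op_norm_nonneg [OF bm [OF S]] by (simp add: simps)
    qed
    show "nrm l2_operators (c \<odot>\<^bsub>l2_operators\<^esub> S) = cmod c * nrm l2_operators S"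
    proof (cases "c = 0")
      case True
      have "op_norm (\<lambda>x. cscale 0 (S x)) \<le> 0 * op_norm S"
        using op_norm_scale_le [OF bm [OF S], of 0] by simp
      then show ?thesis
        using True op_norm_nonneg [OF adjoint_pairD(1) [OF adjoint_pair_scale [OF pair [OF S]]], of 0]
        by (simp add: simps)
    next
      case False
      \<comment> \<open>The nontrivial inequality is the trivial one for \<open>inverse c\<close> and \<open>c S\<close>.\<close>
      have "op_norm S = op_norm (\<lambda>x. cscale (inverse c) (cscale c (S x)))"
        using False by (simp add: cscale_def mult.assoc [symmetric])
      also have "\<dots> \<le> cmod (inverse c) * op_norm (\<lambda>x. cscale c (S x))"
        by (rule op_norm_scale_le [OF adjoint_pairD(1) [OF adjoint_pair_scale [OF pair [OF S]]]])
      finally have "cmod c * op_norm S \<le> op_norm (\<lambda>x. cscale c (S x))"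
        using False by (simp add: norm_divide field_simps)
      then show ?thesis
        using op_norm_scale_le [OF bm [OF S], of c] by (simp add: simps)
    qed
    show "nrm l2_operators (star l2_operators S \<otimes>\<^bsub>l2_operators\<^esub> S) = (nrm l2_operators S)\<^sup>2"
      unfolding simps by (rule op_norm_cstar [OF pair [OF S]])
    assume T: "T \<in> carrier l2_operators"
    show "c \<odot>\<^bsub>l2_operators\<^esub> (S \<oplus>\<^bsub>l2_operators\<^esub> T) =
        c \<odot>\<^bsub>l2_operators\<^esub> S \<oplus>\<^bsub>l2_operators\<^esub> c \<odot>\<^bsub>l2_operators\<^esub> T"
      by (simp add: simps cscale_def fun_eq_iff distrib_left)
    show "(c \<odot>\<^bsub>l2_operators\<^esub> S) \<otimes>\<^bsub>l2_operators\<^esub> T = c \<odot>\<^bsub>l2_operators\<^esub> (S \<otimes>\<^bsub>l2_operators\<^esub> T)"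
      by (simp add: simps fun_eq_iff)
    show "S \<otimes>\<^bsub>l2_operators\<^esub> (c \<odot>\<^bsub>l2_operators\<^esub> T) = c \<odot>\<^bsub>l2_operators\<^esub> (S \<otimes>\<^bsub>l2_operators\<^esub> T)"
      by (simp add: simps fun_eq_iff adjoint_pair_linear(2) [OF pair [OF S]]
          adjoint_pairD(3) [OF pair [OF T]])
    show "star l2_operators (S \<oplus>\<^bsub>l2_operators\<^esub> T) =
        star l2_operators S \<oplus>\<^bsub>l2_operators\<^esub> star l2_operators T"
      unfolding simps by (rule star_l2_operators [OF adjoint_pair_add [OF pair [OF S] pair [OF T]]])
    show "star l2_operators (S \<otimes>\<^bsub>l2_operators\<^esub> T) =
        star l2_operators T \<otimes>\<^bsub>l2_operators\<^esub> star l2_operators S"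
      unfolding simps by (rule star_l2_operators [OF adjoint_pair_comp [OF pair [OF S] pair [OF T]]])
    show "nrm l2_operators (S \<oplus>\<^bsub>l2_operators\<^esub> T) \<le> nrm l2_operators S + nrm l2_operators T"
      unfolding simps
    proof (rule op_norm_le)
      show "0 \<le> op_norm S + op_norm T" by (simp add: op_norm_nonneg bm S T)
      fix x assume x: "x \<in> l2"
      have "l2_norm ((S + T) x) \<le> l2_norm (S x) + l2_norm (T x)"
        by (simp add: l2_add adjoint_pairD(3) [OF pair [OF S]] adjoint_pairD(3) [OF pair [OF T]])
      also have "\<dots> \<le> op_norm S * l2_norm x + op_norm T * l2_norm x"
        by (intro add_mono l2_norm_le_op_norm bm S T x)
      finally show "l2_norm ((S + T) x) \<le> (op_norm S + op_norm T) * l2_norm x"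
        by (simp add: distrib_right)
    qed
    show "nrm l2_operators (S \<otimes>\<^bsub>l2_operators\<^esub> T) \<le> nrm l2_operators S * nrm l2_operators T"
      unfolding simps by (rule op_norm_comp_le [OF bm [OF S] bm [OF T]])
  next
    fix X :: "nat \<Rightarrow> sequence_operator"
    assume X: "\<And>n. X n \<in> carrier l2_operators"
      and "\<forall>\<epsilon>>0. \<exists>N. \<forall>m\<ge>N. \<forall>n\<ge>N. nrm l2_operators (X m \<ominus>\<^bsub>l2_operators\<^esub> X n) < \<epsilon>"
    then have "\<exists>T\<in>carrier l2_operators. (\<lambda>n. op_norm (X n - T)) \<longlonglongrightarrow> 0"
      by (intro complete_l2_operators) (simp_all add: simps minus_l2_operators)
    then show "\<exists>T\<in>carrier l2_operators. (\<lambda>n. nrm l2_operators (X n \<ominus>\<^bsub>l2_operators\<^esub> T)) \<longlonglongrightarrow> 0"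
      using X by (auto simp: simps minus_l2_operators)
  qed
qed

section \<open>Shift and doubling operators\<close>

text \<open>
  For injective \<open>\<tau>\<close>, the isometry that sends the unit vector at \<open>i\<close> to the unit vector at \<open>\<tau> i\<close>;
  its adjoint is \<open>pull \<tau>\<close>.
\<close>

definition push :: "(nat \<Rightarrow> nat) \<Rightarrow> sequence_operator" where
  "push \<tau> x = (if x \<in> l2 then (\<lambda>j. if j \<in> range \<tau> then x (inv_into UNIV \<tau> j) else 0) else 0)"

definition pull :: "(nat \<Rightarrow> nat) \<Rightarrow> sequence_operator" where
  "pull \<tau> x = (if x \<in> l2 then x \<circ> \<tau> else 0)"

lemma adjoint_pair_push_pull:
  assumes inj: "inj \<tau>"
  shows "adjoint_pair (push \<tau>) (pull \<tau>)"
proof -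
  have push: "push \<tau> x \<in> l2 \<and> l2_norm (push \<tau> x) = l2_norm x" if x: "x \<in> l2" for x
  proof -
    have "((\<lambda>i. (cmod (x i))\<^sup>2) has_sum (\<Sum>\<^sub>\<infinity>i. (cmod (x i))\<^sup>2)) UNIV"
      using x by (simp add: l2_def)
    then have "((\<lambda>j. (cmod (x (inv_into UNIV \<tau> j)))\<^sup>2) has_sum (\<Sum>\<^sub>\<infinity>i. (cmod (x i))\<^sup>2)) (range \<tau>)"
      using inj by (subst has_sum_reindex) (simp_all add: o_def)
    moreover have "((\<lambda>j. (cmod (x (inv_into UNIV \<tau> j)))\<^sup>2) has_sum a) (range \<tau>) \<longleftrightarrow>
        ((\<lambda>j. (cmod (push \<tau> x j))\<^sup>2) has_sum a) UNIV" for a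
      by (rule has_sum_cong_neutral) (use x in \<open>auto simp: push_def\<close>)
    ultimately have "((\<lambda>j. (cmod (push \<tau> x j))\<^sup>2) has_sum (\<Sum>\<^sub>\<infinity>i. (cmod (x i))\<^sup>2)) UNIV"
      by blast
    then show ?thesis
      by (auto simp: l2_def l2_norm_def infsumI intro: has_sum_imp_summable)
  qed
  have pull: "pull \<tau> x \<in> l2 \<and> l2_norm (pull \<tau> x) \<le> l2_norm x" if x: "x \<in> l2" for x
  proof -
    have "L2_set (\<lambda>i. cmod (pull \<tau> x i)) F \<le> l2_norm x" if "finite F" for F
    proof -
      have "L2_set (\<lambda>i. cmod (pull \<tau> x i)) F = L2_set (\<lambda>i. cmod (x i)) (\<tau> ` F)"
        unfolding L2_set_def using x inj
        by (subst sum.reindex) (auto simp: pull_def inj_on_def)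
      also have "\<dots> \<le> l2_norm x" using that x by (intro L2_set_le_l2_norm) simp_all
      finally show ?thesis .
    qed
    from l2_boundedI [OF this] show ?thesis by simp
  qed
  have ip: "inner_l2 (push \<tau> x) y = inner_l2 x (pull \<tau> y)" if "x \<in> l2" "y \<in> l2" for x y
  proof -
    have "inner_l2 (push \<tau> x) y = (\<Sum>\<^sub>\<infinity>j\<in>range \<tau>. x (inv_into UNIV \<tau> j) * cnj (y j))"
      unfolding inner_l2_def using that
      by (intro infsum_cong_neutral) (auto simp: push_def)
    also have "\<dots> = inner_l2 x (pull \<tau> y)"
      using that inj by (simp add: infsum_reindex inner_l2_def pull_def o_def)
    finally show ?thesis .
  qed
  have "bounded_map (push \<tau>)"
  proof (rule bounded_mapI [of _ 1])
    show "push \<tau> x \<in> l2" for x using push by (cases "x \<in> l2") (simp_all add: push_def)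
  qed (use push in \<open>simp_all add: push_def\<close>)
  moreover have "bounded_map (pull \<tau>)"
  proof (rule bounded_mapI [of _ 1])
    show "pull \<tau> x \<in> l2" for x using pull by (cases "x \<in> l2") (simp_all add: pull_def)
  qed (use pull in \<open>simp_all add: pull_def\<close>)
  ultimately show ?thesis unfolding adjoint_pair_def using ip by blast
qed

lemma push_pull_l2:
  assumes "inj \<tau>"
  shows "push \<tau> x \<in> l2" "pull \<tau> x \<in> l2"
  using adjoint_pair_push_pull [OF assms] adjoint_pairD(3) adjoint_pair_sym by blast+

lemma pull_push: "inj \<tau> \<Longrightarrow> pull \<tau> (push \<tau> x) = (if x \<in> l2 then x else 0)"
  unfolding pull_def using push_pull_l2(1) [of \<tau> x] by (auto simp: push_def fun_eq_iff)

lemma push_apply_image: "inj \<tau> \<Longrightarrow> x \<in> l2 \<Longrightarrow> push \<tau> x (\<tau> i) = x i"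
  by (simp add: push_def)

lemma push_apply_outside: "j \<notin> range \<tau> \<Longrightarrow> push \<tau> x j = 0"
  by (simp add: push_def)

lemma pull_apply: "x \<in> l2 \<Longrightarrow> pull \<tau> x i = x (\<tau> i)"
  by (simp add: pull_def)

lemma push_push:
  assumes "inj \<tau>" "inj \<rho>"
  shows "push \<tau> (push \<rho> x) = push (\<tau> \<circ> \<rho>) x"
proof (cases "x \<in> l2")
  case True
  have inj: "inj (\<tau> \<circ> \<rho>)" using assms by (simp add: inj_compose)
  show ?thesis
  proof
    fix j
    consider i where "j = \<tau> (\<rho> i)" | i where "j = \<tau> i" "i \<notin> range \<rho>" | "j \<notin> range \<tau>" by blast
    then show "push \<tau> (push \<rho> x) j = push (\<tau> \<circ> \<rho>) x j"
    proof cases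
      case 1
      then show ?thesis
        using push_apply_image [OF inj True, of i] assms True
        by (simp add: push_apply_image push_pull_l2)
    next
      case 2
      then have "j \<notin> range (\<tau> \<circ> \<rho>)" using assms(1) by (auto dest: injD)
      then show ?thesis
        using 2 assms by (simp add: push_apply_image push_apply_outside push_pull_l2)
    next
      case 3
      then have "j \<notin> range (\<tau> \<circ> \<rho>)" by auto
      then show ?thesis using 3 by (simp add: push_apply_outside)
    qed
  qed
next
  case False
  then show ?thesis by (simp add: push_def fun_eq_iff)
qed

lemma push_pull:
  assumes "inj \<tau>" "x \<in> l2"
  shows "push \<tau> (pull \<tau> x) j = (if j \<in> range \<tau> then x j else 0)"
  using assms push_apply_image [OF assms(1) push_pull_l2(2) [OF assms(1)], of x]
  by (auto simp: push_apply_outside pull_apply)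

text \<open>
  Under \<open>push\<close> the operator relations become statements about indices: \<open>\<sigma>\<close> doubles with respect to the
  translation \<open>\<pi>\<close>, and the "even" and "odd" indices partition the index set.
\<close>

lemma two_adic_relations_push:
  assumes \<pi>: "bij \<pi>" and \<sigma>: "inj \<sigma>" and comm: "\<sigma> \<circ> \<pi> = \<pi> \<circ> \<pi> \<circ> \<sigma>"
    and part: "range \<sigma> \<inter> range (\<pi> \<circ> \<sigma>) = {}" "range \<sigma> \<union> range (\<pi> \<circ> \<sigma>) = UNIV"
  shows "two_adic_relations l2_operators (push \<pi>) (push \<sigma>)"
proof -
  have inj: "inj \<pi>" and range: "range \<pi> = UNIV" using \<pi> by (auto simp: bij_def)
  note pairs = adjoint_pair_push_pull [OF inj] adjoint_pair_push_pull [OF \<sigma>]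
  note stars = pairs [THEN star_l2_operators]
  have \<pi>\<sigma>: "inj (\<pi> \<circ> \<sigma>)" "inj (\<pi> \<circ> \<pi>)" "inj (\<sigma> \<circ> \<pi>)"
    using inj \<sigma> by (simp_all add: inj_compose)
  have unit: "push \<pi> (pull \<pi> x) = (if x \<in> l2 then x else 0)" for x
  proof (cases "x \<in> l2")
    case True
    then show ?thesis using range by (simp add: push_pull [OF inj] fun_eq_iff)
  next
    case False
    then have "pull \<pi> x = 0" "push \<pi> 0 = 0"
      by (simp_all add: pull_def push_def fun_eq_iff)
    then show ?thesis using False by simp
  qed
  have comp: "push \<tau> \<circ> push \<rho> = push (\<tau> \<circ> \<rho>)" if "inj \<tau>" "inj \<rho>" for \<tau> \<rho>
    by (rule ext) (simp add: push_push that)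
  have "push \<sigma> \<circ> push \<pi> = push \<pi> \<circ> push \<pi> \<circ> push \<sigma>"
    by (simp only: comp inj \<sigma> \<pi>\<sigma> comm)
  moreover have "push \<sigma> (pull \<sigma> x) + push \<pi> (push \<sigma> (pull \<sigma> (pull \<pi> x))) = (if x \<in> l2 then x else 0)"
    for x
  proof (cases "x \<in> l2")
    case True
    have "pull \<sigma> (pull \<pi> x) = pull (\<pi> \<circ> \<sigma>) x"
      using True push_pull_l2(2) [OF inj, of x] by (simp add: pull_def o_assoc)
    then have "push \<pi> (push \<sigma> (pull \<sigma> (pull \<pi> x))) = push (\<pi> \<circ> \<sigma>) (pull (\<pi> \<circ> \<sigma>) x)"
      using inj \<sigma> by (simp add: push_push)
    then show ?thesis
      using True part by (auto simp: fun_eq_iff push_pull [OF \<sigma>] push_pull [OF \<pi>\<sigma>(1)])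
  next
    case False
    then have "pull \<pi> x = 0" "pull \<sigma> x = 0" "push \<pi> 0 = 0" "push \<sigma> 0 = 0" "pull \<sigma> 0 = 0"
      by (simp_all add: pull_def push_def fun_eq_iff)
    then show ?thesis using False by simp
  qed
  ultimately show ?thesis
    unfolding two_adic_relations_def is_unitary_def is_isometry_def
    using pairs inj \<sigma>
    by (auto simp: l2_operators_simps stars fun_eq_iff pull_push unit numeral_2_eq_2
        monoid.nat_pow_Suc nat_pow_def push_pull_l2)
qed

lemma one_neq_zero_l2_operators: "\<one>\<^bsub>l2_operators\<^esub> \<noteq> \<zero>\<^bsub>l2_operators\<^esub>"
proof
  define x :: "nat \<Rightarrow> complex" where "x i = (if i = 0 then 1 else 0)" for i
  have "x \<in> l2"
    unfolding l2_def mem_Collect_eq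
    by (rule finite_nonzero_values_imp_summable_on) (simp add: x_def)
  moreover assume "\<one>\<^bsub>l2_operators\<^esub> = \<zero>\<^bsub>l2_operators\<^esub>"
  ultimately have "x 0 = 0" by (metis l2_operators_simps(3,4) zero_fun_apply)
  then show False by (simp add: x_def)
qed

text \<open>
  The translation \<open>k \<mapsto> k + 1\<close> and the doubling \<open>k \<mapsto> 2 k\<close> of the integers, moved to the natural
  numbers along a bijection.
\<close>

theorem two_adic_relations_l2_operators:
  "\<exists>u s. two_adic_relations l2_operators u s"
proof -
  define \<pi> where "\<pi> = int_encode \<circ> (\<lambda>k. k + 1) \<circ> int_decode"
  define \<sigma> where "\<sigma> = int_encode \<circ> (\<lambda>k. 2 * k) \<circ> int_decode"
  have "bij (\<lambda>k::int. k + 1)" by (rule bij_betw_byWitness [of _ "\<lambda>k. k - 1"]) auto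
  then have "bij \<pi>"
    unfolding \<pi>_def by (intro bij_comp bij_int_encode bij_int_decode)
  moreover have "inj \<sigma>"
    unfolding \<sigma>_def by (intro inj_compose inj_int_encode inj_int_decode) (auto simp: inj_def)
  moreover have "\<sigma> \<circ> \<pi> = \<pi> \<circ> \<pi> \<circ> \<sigma>"
    by (simp add: \<pi>_def \<sigma>_def fun_eq_iff algebra_simps)
  moreover have "j \<in> range \<sigma> \<longleftrightarrow> even (int_decode j)" for j
  proof
    assume "even (int_decode j)"
    then obtain k where "int_decode j = 2 * k" by (auto elim: evenE)
    then have "j = \<sigma> (int_encode k)"
      by (simp add: \<sigma>_def) (metis int_decode_inverse)
    then show "j \<in> range \<sigma>" by blast
  qed (auto simp: \<sigma>_def)
  moreover have "j \<in> range (\<pi> \<circ> \<sigma>) \<longleftrightarrow> odd (int_decode j)" for j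
  proof
    assume "odd (int_decode j)"
    then obtain k where "int_decode j = 2 * k + 1" by (auto elim: oddE)
    then have "j = (\<pi> \<circ> \<sigma>) (int_encode k)"
      by (simp add: \<pi>_def \<sigma>_def) (metis int_decode_inverse)
    then show "j \<in> range (\<pi> \<circ> \<sigma>)" by blast
  qed (auto simp: \<pi>_def \<sigma>_def)
  ultimately show ?thesis
    by (intro exI [of _ "push \<pi>"] exI [of _ "push \<sigma>"] two_adic_relations_push) auto
qed

section \<open>Reduction of the matrix relations\<close>

context two_adic_pair
begin

definition range_flip :: 'a where
  "range_flip = U \<otimes> S \<otimes> (U \<otimes> S)\<^sup>\<star> \<ominus> S \<otimes> S\<^sup>\<star>"

lemma range_flip_closed: "range_flip \<in> carrier A"
  by (simp add: range_flip_def generators_closed star_closed)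

lemma range_flip_star: "range_flip\<^sup>\<star> = range_flip"
  by (simp add: range_flip_def generators_closed star_simps)

lemma range_flip_unique:
  assumes x: "x \<in> carrier A" and S1: "x \<otimes> (U \<otimes> S) = U \<otimes> S" and S2: "x \<otimes> S = \<ominus> S"
  shows "x = range_flip"
proof -
  note cl = x generators_closed
  have "x = x \<otimes> (S \<otimes> S\<^sup>\<star> \<oplus> U \<otimes> S \<otimes> S\<^sup>\<star> \<otimes> U\<^sup>\<star>)"
    using cl by (simp add: range_sum)
  also have "\<dots> = (x \<otimes> (U \<otimes> S)) \<otimes> (U \<otimes> S)\<^sup>\<star> \<oplus> (x \<otimes> S) \<otimes> S\<^sup>\<star>"
    using cl by (simp add: r_distr m_assoc star_mult a_comm)
  also have "\<dots> = range_flip"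
    unfolding S1 S2 range_flip_def using cl by (simp add: l_minus minus_eq star_closed)
  finally show ?thesis .
qed

text \<open>
  The relations that are left for the first row \<open>(a, b)\<close> of the matrix once its second row is known to
  be \<open>(-b, -a)\<close>. Adding and subtracting the two relations for \<open>a + b\<close> yields its relations with \<open>R\<close>
  and \<open>Q\<close>.
\<close>

lemma no_intertwining_pair:
  assumes gen: "cstar_generated_by A {U, S}" and nontriv: "\<one> \<noteq> \<zero>"
    and ab: "a \<in> carrier A" "b \<in> carrier A"
    and sum: "(a \<oplus> b) \<otimes> (U \<otimes> S) = U \<otimes> S \<otimes> a \<oplus> S \<otimes> b" "(a \<oplus> b) \<otimes> S = U \<otimes> S \<otimes> b \<oplus> S \<otimes> a"
    and diff: "(a \<ominus> b) \<otimes> (U \<otimes> S) = U \<otimes> S" "(a \<ominus> b) \<otimes> S = \<ominus> S"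
  shows False
proof (rule no_intertwiner [OF gen nontriv])
  define s1 where "s1 = U \<otimes> S"
  have cl: "s1 \<in> carrier A" "S \<in> carrier A" by (simp_all add: s1_def generators_closed)
  note sum = sum [folded s1_def]
  show "a \<oplus> b \<in> carrier A" "a \<ominus> b \<in> carrier A" using ab by simp_all
  have "(a \<oplus> b) \<otimes> (s1 \<oplus> S) = (a \<oplus> b) \<otimes> s1 \<oplus> (a \<oplus> b) \<otimes> S"
    using cl ab by (simp add: r_distr)
  also have "\<dots> = (s1 \<oplus> S) \<otimes> (a \<oplus> b)"
    unfolding sum using cl ab by algebra
  finally show "(a \<oplus> b) \<otimes> R = R \<otimes> (a \<oplus> b)"
    using cl ab by (simp add: R_def smult_mult_left smult_mult_right flip: s1_def)
  have "(a \<oplus> b) \<otimes> (s1 \<ominus> S) = (a \<oplus> b) \<otimes> s1 \<ominus> (a \<oplus> b) \<otimes> S"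
    using cl ab by (simp add: r_distr minus_eq r_minus)
  also have "\<dots> = (s1 \<ominus> S) \<otimes> (a \<ominus> b)"
    unfolding sum using cl ab by algebra
  finally show "(a \<oplus> b) \<otimes> Q = Q \<otimes> (a \<ominus> b)"
    using cl ab by (simp add: Q_def smult_mult_left smult_mult_right flip: s1_def)
qed (rule diff)+

lemma half_sqrt_cancel:
  assumes "x \<in> carrier A" "y \<in> carrier A" "half_sqrt \<odot> x = half_sqrt \<odot> y"
  shows "x = y"
proof -
  have "half_sqrt \<noteq> 0" by (simp add: half_sqrt_def)
  then have inv: "z = inverse half_sqrt \<odot> (half_sqrt \<odot> z)" if "z \<in> carrier A" for z
    using that by (simp add: smult_smult [symmetric] smult_one)
  show ?thesis using inv [OF assms(1)] inv [OF assms(2)] assms(3) by simp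
qed

end

text \<open>
  The universal property provides a unital homomorphism into a nonzero algebra.
\<close>

lemma two_adic_ring_algebra_nontrivial:
  assumes "is_two_adic_ring_algebra A U S"
  shows "\<one>\<^bsub>A\<^esub> \<noteq> \<zero>\<^bsub>A\<^esub>"
proof
  assume eq: "\<one>\<^bsub>A\<^esub> = \<zero>\<^bsub>A\<^esub>"
  obtain u s where "two_adic_relations l2_operators u s"
    using two_adic_relations_l2_operators by blast
  then obtain \<phi> where \<phi>: "\<phi> \<in> ring_hom A l2_operators"
    using assms unital_cstar_algebra_l2_operators
    unfolding is_two_adic_ring_algebra_def star_hom_def by blast
  have "ring A"
    using assms unfolding is_two_adic_ring_algebra_def unital_cstar_algebra_def by blast
  then have "\<phi> \<zero>\<^bsub>A\<^esub> = \<zero>\<^bsub>l2_operators\<^esub>"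
    by (rule ring_hom_zero [OF \<phi> _ ring_l2_operators])
  moreover have "\<phi> \<one>\<^bsub>A\<^esub> = \<one>\<^bsub>l2_operators\<^esub>"
    by (rule ring_hom_one [OF \<phi>])
  ultimately show False using eq one_neq_zero_l2_operators by simp
qed

theorem theorem5p1:
  fixes A :: "'a normed_star_alg" (structure)
    and M :: "'a mat2 star_alg"
    and U S1 S2 :: 'a
    and T1 T2 Z :: "'a mat2"
  assumes Q2: "is_two_adic_ring_algebra A U S2"
    and S1: "S1 = U \<otimes> S2"
    and M: "M = mat2_alg A"
    and T1: "T1 = complex_of_real (1 / sqrt 2) \<odot>\<^bsub>M\<^esub> Mat2 S1 S2 S1 S2"
    and T2: "T2 = complex_of_real (1 / sqrt 2) \<odot>\<^bsub>M\<^esub> Mat2 S1 (\<ominus> S2) (\<ominus> S1) S2"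
    and Z: "Z = Mat2 \<one> \<zero> \<zero> (\<ominus> \<one>)"
  shows "\<not> (\<exists>V. is_unitary M V \<and>
               V \<otimes>\<^bsub>M\<^esub> T2 = T1 \<and>
               V \<otimes>\<^bsub>M\<^esub> T1 = T2 \<otimes>\<^bsub>M\<^esub> V \<and>
               Z \<otimes>\<^bsub>M\<^esub> V \<otimes>\<^bsub>M\<^esub> star M Z = star M V)"
proof
  assume "\<exists>V. is_unitary M V \<and> V \<otimes>\<^bsub>M\<^esub> T2 = T1 \<and> V \<otimes>\<^bsub>M\<^esub> T1 = T2 \<otimes>\<^bsub>M\<^esub> V \<and>
    Z \<otimes>\<^bsub>M\<^esub> V \<otimes>\<^bsub>M\<^esub> star M Z = star M V"
  then obtain V where V: "V \<in> carrier M" and VT2: "V \<otimes>\<^bsub>M\<^esub> T2 = T1"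
    and VT1: "V \<otimes>\<^bsub>M\<^esub> T1 = T2 \<otimes>\<^bsub>M\<^esub> V" and ZV: "Z \<otimes>\<^bsub>M\<^esub> V \<otimes>\<^bsub>M\<^esub> star M Z = star M V"
    unfolding is_unitary_def by blast
  interpret two_adic_pair A U S2
    using Q2 unfolding is_two_adic_ring_algebra_def two_adic_pair_def two_adic_pair_axioms_def by blast
  have gen: "cstar_generated_by A {U, S2}"
    using Q2 unfolding is_two_adic_ring_algebra_def by blast
  obtain a b c d where Vd: "V = Mat2 a b c d" by (cases V)
  have cl: "a \<in> carrier A" "b \<in> carrier A" "c \<in> carrier A" "d \<in> carrier A"
    "S1 \<in> carrier A" "S2 \<in> carrier A"
    using V generators_closed unfolding M Vd S1 mat2_alg_def by auto
  note entries = M T1 T2 Z Vd mat2_alg_def half_sqrt_def [symmetric]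
  \<comment> \<open>Conjugation by \<open>Z\<close> changes the sign of the off-diagonal entries.\<close>
  have adj: "a\<^sup>\<star> = a" "b\<^sup>\<star> = \<ominus> c"
    using ZV cl unfolding entries by (simp_all add: star_simps l_minus r_minus)
  \<comment> \<open>The entries of \<open>V T2 = T1\<close>: both rows of \<open>V\<close> have the difference \<open>range_flip\<close>.\<close>
  have "half_sqrt \<odot> ((a \<ominus> b) \<otimes> S1) = half_sqrt \<odot> S1"
    "half_sqrt \<odot> ((b \<ominus> a) \<otimes> S2) = half_sqrt \<odot> S2"
    "half_sqrt \<odot> ((c \<ominus> d) \<otimes> S1) = half_sqrt \<odot> S1"
    "half_sqrt \<odot> ((d \<ominus> c) \<otimes> S2) = half_sqrt \<odot> S2"
    using VT2 cl unfolding entries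
    by (simp_all add: smult_simps smult_uminus minus_eq l_distr l_minus r_minus a_comm)
  then have "(a \<ominus> b) \<otimes> S1 = S1" "(b \<ominus> a) \<otimes> S2 = S2" "(c \<ominus> d) \<otimes> S1 = S1" "(d \<ominus> c) \<otimes> S2 = S2"
    using cl by (simp_all add: half_sqrt_cancel)
  moreover have "(a \<ominus> b) \<otimes> S2 = \<ominus> ((b \<ominus> a) \<otimes> S2)" "(c \<ominus> d) \<otimes> S2 = \<ominus> ((d \<ominus> c) \<otimes> S2)"
    using cl by algebra+
  ultimately have diff: "(a \<ominus> b) \<otimes> S1 = S1" "(a \<ominus> b) \<otimes> S2 = \<ominus> S2"
    "(c \<ominus> d) \<otimes> S1 = S1" "(c \<ominus> d) \<otimes> S2 = \<ominus> S2"
    by simp_all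
  have ab: "a \<ominus> b = range_flip" and cd: "c \<ominus> d = range_flip"
    using cl diff by (simp_all add: range_flip_unique S1)
  have "b = a \<ominus> range_flip" using cl unfolding ab [symmetric] by algebra
  then have "b\<^sup>\<star> = b" using cl by (simp add: star_diff range_flip_closed range_flip_star adj)
  then have c: "c = \<ominus> b" using cl adj(2) by (metis minus_minus)
  have d: "d = \<ominus> a"
  proof -
    have "d = c \<ominus> (c \<ominus> d)" using cl by algebra
    also have "\<dots> = c \<ominus> (a \<ominus> b)" by (simp only: ab cd)
    also have "\<dots> = \<ominus> a" unfolding c using cl by algebra
    finally show ?thesis .
  qed
  \<comment> \<open>The first row of \<open>V T1 = T2 V\<close>; the second row is its negative.\<close>
  have "half_sqrt \<odot> ((a \<oplus> b) \<otimes> S1) = half_sqrt \<odot> (S1 \<otimes> a \<oplus> S2 \<otimes> b)"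
    "half_sqrt \<odot> ((a \<oplus> b) \<otimes> S2) = half_sqrt \<odot> (S1 \<otimes> b \<oplus> S2 \<otimes> a)"
    using VT1 cl unfolding entries c d
    by (simp_all add: smult_simps smult_uminus l_distr l_minus r_minus)
  then have "(a \<oplus> b) \<otimes> S1 = S1 \<otimes> a \<oplus> S2 \<otimes> b" "(a \<oplus> b) \<otimes> S2 = S1 \<otimes> b \<oplus> S2 \<otimes> a"
    using cl by (simp_all add: half_sqrt_cancel)
  with no_intertwining_pair [OF gen two_adic_ring_algebra_nontrivial [OF Q2]] cl diff
  show False by (simp add: S1)
qed

end
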